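(* Let $G$ be a countable discrete amenable group, $\Lambda$ a strongly connected finite $k$-graph, and $(G,\Lambda)$ a pseudo free and locally faithful self-similar action satisfying the finite-state condition, with $x_\Lambda(g\cdot v)=x_\Lambda(v)$ for all $v\in\Lambda^0$, $g\in G$. If $\phi$ is a KMS state of $\mathcal{O}_{G,\Lambda}$, then for all $\mu,\nu\in\Lambda$ and $g\in G$ with $s(\mu)=g\cdot s(\nu)$, $$\phi(s_\mu u_gs_\nu^* )=\begin{cases}\rho(\Lambda)^{-d(\mu)}x_\Lambda(s(\mu))\,\phi(V_{d(\mu),d(\nu)}) & \text{if }(\mu,g,\nu)\in\mathcal{C}_{G,\Lambda},\\ 0&\text{otherwise.}\end{cases}$$
   Context: Let $k\ge1$. A $k$-graph is a countable small category $\Lambda$ together with a functor $d:\Lambda\to\mathbb{N}^k$ (the degree map) with the unique factorization property: for every $\mu\in\Lambda$ and $m,n\in\mathbb{N}^k$ with $d(\mu)=m+n$ there are unique $\alpha,\beta\in\Lambda$ with $d(\alpha)=m$, $d(\beta)=n$ and $\mu=\alpha\beta$. Write $\Lambda^n=d^{-1}(n)$; $\Lambda^0$ is identified with the set of objects (vertices), and $r,s$ denote range and source. For $v,w\in\Lambda^0$ and $n\in\mathbb{N}^k$ write $v\Lambda=r^{-1}(v)$, $v\Lambda w=r^{-1}(v)\cap s^{-1}(w)$, $v\Lambda^n=v\Lambda\cap\Lambda^n$, etc. All $k$-graphs are assumed row-finite ($|v\Lambda^n|<\infty$) and source-free ($v\Lambda^n\neq\emptyset$) for all $v,n$. $\Lambda$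 is finite if $|\Lambda^n|<\infty$ for all $n$, and strongly connected if $v\Lambda w\neq\emptyset$ for all $v,w\in\Lambda^0$. $e_1,\dots,e_k$ is the standard basis of $\mathbb{N}^k$. Infinite paths: let $\Omega_k=\{(p,q)\in\mathbb{N}^k\times\mathbb{N}^k:p\le q\}$ with $r(p,q)=(p,p)$, $s(p,q)=(q,q)$, $(p,q)(q,m)=(p,m)$, $d(p,q)=q-p$. An infinite path is a degree-preserving functor $x:\Omega_k\to\Lambda$; $\Lambda^\infty$ is the set of infinite paths, $v\Lambda^\infty=\{x:x(0,0)=v\}$, the shift is $\sigma^n(x)(p,q)=x(p+n,q+n)$, and for $\mu\in\Lambda$, $x\in s(\mu)\Lambda^\infty$, $\mu x$ is the unique infinite path $y$ with $y(0,d(\mu))=\mu$ and $\sigma^{d(\mu)}(y)=x$. Self-similar actions: $G$ is a countable discrete group. A self-similar action $(G,\Lambda)$ consists of an action of $G$ on $\Lambda$ by automorphisms (bijections preserving $d$, $r$, $s$), written $g\cdot\mu$, and a restriction map $G\times\Lambda\to G$, $(g,\mu)\mapsto g|_\mu$, such that for all $g,h\in G$, $v\in\Lambda^0$ and $\mu,\nu$ with $s(\mu)=r(\nu)$: $g\cdot(\mu\nu)=(g\cdot\mu)(g|_\mu\cdot\nu)$; $g|_v=g$; $g|_{\mu\nu}=(g|_\mu)|_\nu$; $1_G|_\mu=1_G$; $(gh)|_\mu=g|_{h\cdot\mu}\,h|_\mu$. For $x\in\Lambda^\infty$, $(g\cdot x)(p,q)=g|_{x(0,p)}\cdot x(p,q)$.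 The action is pseudo free if $g\cdot\mu=\mu$ and $g|_\mu=1_G$ for some $\mu\in\Lambda$ imply $g=1_G$; locally faithful if, whenever $g\in G$, $v\in\Lambda^0$ and $g\cdot\mu=\mu$ for all $\mu\in v\Lambda$, then $g=1_G$; it satisfies the finite-state condition if $\{g|_\mu:\mu\in\Lambda\}$ is finite for each $g\in G$. Cycline triples and periodicity: a triple $(\mu,g,\nu)\in\Lambda\times G\times\Lambda$ with $s(\mu)=g\cdot s(\nu)$ is cycline if $\mu(g\cdot x)=\nu x$ for all $x\in s(\nu)\Lambda^\infty$; $\mathcal{C}_{G,\Lambda}$ is the set of cycline triples and $\mathcal{C}^{m,n}_{G,\Lambda}$ the set of those with $d(\mu)=m$, $d(\nu)=n$. $\mathrm{Per}_{G,\Lambda}=\{d(\mu)-d(\nu):(\mu,g,\nu)\in\mathcal{C}_{G,\Lambda}\}\subseteq\mathbb{Z}^k$. The algebra: for a self-similar action with $|\Lambda^0|<\infty$, $\mathcal{O}_{G,\Lambda}$ is the universal unital C*-algebra generated by unitaries $\{u_g\}_{g\in G}$ and partial isometries $\{s_\mu\}_{\mu\in\Lambda}$ such that $\{s_v\}_{v\in\Lambda^0}$ are mutually orthogonal projections; $s_{\mu\nu}=s_\mu s_\nu$ when $s(\mu)=r(\nu)$; $s_\mu^*s_\mu=s_{s(\mu)}$; $s_v=\sum_{\mu\in v\Lambda^n}s_\mu s_\mu^*$ for all $v\in\Lambda^0$, $n\in\mathbb{N}^k$; $u_{gh}=u_gu_h$; and $u_gs_\mu=s_{g\cdot\mu}u_{g|_\mu}$.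 For $m,n\in\mathbb{N}^k$ with $m-n\in\mathrm{Per}_{G,\Lambda}$, $V_{m,n}=\sum_{(\mu,g,\nu)\in\mathcal{C}^{m,n}_{G,\Lambda}}s_\mu u_gs_\nu^*$ (a finite sum). Note: if $(\mu,g,\nu)$ is cycline then $d(\mu)-d(\nu)\in\mathrm{Per}_{G,\Lambda}$, so $V_{d(\mu),d(\nu)}$ is defined. Perron–Frobenius data: for a strongly connected finite $k$-graph let $T_{e_i}(v,w)=|v\Lambda^{e_i}w|$, $\rho(\Lambda)=(\rho(T_{e_1}),\dots,\rho(T_{e_k}))$ (spectral radii, all positive), $\rho(\Lambda)^n=\prod_i\rho(T_{e_i})^{n_i}$ for $n\in\mathbb{Z}^k$. The Perron–Frobenius eigenvector $x_\Lambda$ is the unique vector in $(0,\infty)^{\Lambda^0}$ with $\sum_v x_\Lambda(v)=1$ and $T_{e_i}x_\Lambda=\rho(T_{e_i})x_\Lambda$ for all $i$. KMS states: the gauge action $\gamma:\mathbb{T}^k\to\mathrm{Aut}(\mathcal{O}_{G,\Lambda})$ is $\gamma_z(s_\mu)=z^{d(\mu)}s_\mu$, $\gamma_z(u_g)=u_g$, where $z^n=\prod_i z_i^{n_i}$. A KMS state of $\mathcal{O}_{G,\Lambda}$ means a KMS$_1$ state for the dynamics $\alpha_t=\gamma_{(\rho(T_{e_1})^{it},\dots,\rho(T_{e_k})^{it})}$; equivalently, a state $\phi$ with $\phi(s_\mu u_gs_\nu^*\,y)=\rho(\Lambda)^{d(\nu)-d(\mu)}\phi(y\,s_\mu u_gs_\nu^*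 )$ for all $y\in\mathcal{O}_{G,\Lambda}$ and all $\mu,\nu\in\Lambda$, $g\in G$ with $s(\mu)=g\cdot s(\nu)$. *)

theory Defs
  imports "HOL-Analysis.Analysis"
begin

text \<open>A unital complex C*-algebra, presented as a real Banach algebra with unit together with
  a central imaginary unit (giving the complex structure) and an antilinear involution
  satisfying the C*-identity.  Complex scalar multiplication is
  c x = Re c x + Im c (iunit x).\<close>

class cstar_algebra = real_normed_algebra_1 + banach +
  fixes cstar_adj :: "'a \<Rightarrow> 'a"
    and iunit :: 'a
  assumes adj_adj: "cstar_adj (cstar_adj x) = x"
    and adj_add: "cstar_adj (x + y) = cstar_adj x + cstar_adj y"
    and adj_scaleR: "cstar_adj (r *\<^sub>R x) = r *\<^sub>R cstar_adj x"
    and adj_mult: "cstar_adj (x * y) = cstar_adj y * cstar_adj x"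
    and iunit_sq: "iunit * iunit = - 1"
    and iunit_central: "iunit * x = x * iunit"
    and adj_iunit: "cstar_adj iunit = - iunit"
    and norm_cscale: "norm (Re c *\<^sub>R x + Im c *\<^sub>R (iunit * x)) = cmod c * norm x"
    and cstar_identity: "norm (cstar_adj x * x) = norm x ^ 2"

definition cscale :: "complex \<Rightarrow> 'a::cstar_algebra \<Rightarrow> 'a" where
  "cscale c x = Re c *\<^sub>R x + Im c *\<^sub>R (iunit * x)"

definition is_state :: "('a::cstar_algebra \<Rightarrow> complex) \<Rightarrow> bool" where
  "is_state \<phi> \<longleftrightarrow>
     (\<forall>x y. \<phi> (x + y) = \<phi> x + \<phi> y) \<and>
     (\<forall>c x. \<phi> (cscale c x) = c * \<phi> x) \<and>
     (\<forall>x. Im (\<phi> (cstar_adj x * x)) = 0 \<and> Re (\<phi> (cstar_adj x * x)) \<ge> 0) \<and>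
     \<phi> 1 = 1"

text \<open>Groups are written additively (type class group_add, not assumed commutative).
  Amenable: existence of a left-invariant finitely additive probability measure on all
  subsets.\<close>

definition amenable :: "'g::group_add itself \<Rightarrow> bool" where
  "amenable _ \<longleftrightarrow> (\<exists>m :: 'g set \<Rightarrow> real.
      (\<forall>A. m A \<ge> 0) \<and> m UNIV = 1 \<and>
      (\<forall>A B. A \<inter> B = {} \<longrightarrow> m (A \<union> B) = m A + m B) \<and>
      (\<forall>g A. m ((+) g ` A) = m A))"

record ('p, 'k::finite) kgraph =
  Mor :: "'p set"
  rng :: "'p \<Rightarrow> 'p"
  src :: "'p \<Rightarrow> 'p"
  cmp :: "'p \<Rightarrow> 'p \<Rightarrow> 'p"
  deg :: "'p \<Rightarrow> nat ^ 'k"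

definition verts :: "('p, 'k::finite) kgraph \<Rightarrow> 'p set" where
  "verts \<Lambda> = {v \<in> Mor \<Lambda>. deg \<Lambda> v = 0}"

definition is_kgraph :: "('p, 'k::finite) kgraph \<Rightarrow> bool" where
  "is_kgraph \<Lambda> \<longleftrightarrow>
     countable (Mor \<Lambda>) \<and>
     (\<forall>\<mu>\<in>Mor \<Lambda>. rng \<Lambda> \<mu> \<in> verts \<Lambda> \<and> src \<Lambda> \<mu> \<in> verts \<Lambda>) \<and>
     (\<forall>v\<in>verts \<Lambda>. rng \<Lambda> v = v \<and> src \<Lambda> v = v) \<and>
     (\<forall>\<mu>\<in>Mor \<Lambda>. cmp \<Lambda> (rng \<Lambda> \<mu>) \<mu> = \<mu> \<and> cmp \<Lambda> \<mu> (src \<Lambda> \<mu>) = \<mu>) \<and>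
     (\<forall>\<mu>\<in>Mor \<Lambda>. \<forall>\<nu>\<in>Mor \<Lambda>. src \<Lambda> \<mu> = rng \<Lambda> \<nu> \<longrightarrow>
        cmp \<Lambda> \<mu> \<nu> \<in> Mor \<Lambda> \<and> rng \<Lambda> (cmp \<Lambda> \<mu> \<nu>) = rng \<Lambda> \<mu> \<and>
        src \<Lambda> (cmp \<Lambda> \<mu> \<nu>) = src \<Lambda> \<nu> \<and> deg \<Lambda> (cmp \<Lambda> \<mu> \<nu>) = deg \<Lambda> \<mu> + deg \<Lambda> \<nu>) \<and>
     (\<forall>\<mu>\<in>Mor \<Lambda>. \<forall>\<nu>\<in>Mor \<Lambda>. \<forall>\<kappa>\<in>Mor \<Lambda>.
        src \<Lambda> \<mu> = rng \<Lambda> \<nu> \<longrightarrow> src \<Lambda> \<nu> = rng \<Lambda> \<kappa> \<longrightarrow>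
        cmp \<Lambda> (cmp \<Lambda> \<mu> \<nu>) \<kappa> = cmp \<Lambda> \<mu> (cmp \<Lambda> \<nu> \<kappa>)) \<and>
     (\<forall>\<mu>\<in>Mor \<Lambda>. \<forall>m n. deg \<Lambda> \<mu> = m + n \<longrightarrow>
        (\<exists>!(\<alpha>, \<beta>). \<alpha> \<in> Mor \<Lambda> \<and> \<beta> \<in> Mor \<Lambda> \<and> src \<Lambda> \<alpha> = rng \<Lambda> \<beta> \<and>
            deg \<Lambda> \<alpha> = m \<and> deg \<Lambda> \<beta> = n \<and> \<mu> = cmp \<Lambda> \<alpha> \<beta>))"

definition finite_kgraph :: "('p, 'k::finite) kgraph \<Rightarrow> bool" where
  "finite_kgraph \<Lambda> \<longleftrightarrow> (\<forall>n. finite {\<mu> \<in> Mor \<Lambda>. deg \<Lambda> \<mu> = n})"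

definition source_free :: "('p, 'k::finite) kgraph \<Rightarrow> bool" where
  "source_free \<Lambda> \<longleftrightarrow> (\<forall>v\<in>verts \<Lambda>. \<forall>n. \<exists>\<mu>\<in>Mor \<Lambda>. rng \<Lambda> \<mu> = v \<and> deg \<Lambda> \<mu> = n)"

definition row_finite :: "('p, 'k::finite) kgraph \<Rightarrow> bool" where
  "row_finite \<Lambda> \<longleftrightarrow> (\<forall>v\<in>verts \<Lambda>. \<forall>n. finite {\<mu> \<in> Mor \<Lambda>. rng \<Lambda> \<mu> = v \<and> deg \<Lambda> \<mu> = n})"

definition strongly_connected :: "('p, 'k::finite) kgraph \<Rightarrow> bool" where
  "strongly_connected \<Lambda> \<longleftrightarrow>
     (\<forall>v\<in>verts \<Lambda>. \<forall>w\<in>verts \<Lambda>. \<exists>\<mu>\<in>Mor \<Lambda>. rng \<Lambda> \<mu> = v \<and> src \<Lambda> \<mu> = w)"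

text \<open>Infinite paths are degree-preserving functors from Omega_k, represented as functions on
  pairs (p,q), extended by undefined where p is not below q.\<close>

definition inf_paths :: "('p, 'k::finite) kgraph \<Rightarrow> (((nat ^ 'k) \<times> (nat ^ 'k)) \<Rightarrow> 'p) set" where
  "inf_paths \<Lambda> = Collect (\<lambda>x.
     (\<forall>p q. \<not> p \<le> q \<longrightarrow> x (p, q) = undefined) \<and>
     (\<forall>p q. p \<le> q \<longrightarrow> x (p, q) \<in> Mor \<Lambda> \<and> deg \<Lambda> (x (p, q)) = q - p \<and>
                      rng \<Lambda> (x (p, q)) = x (p, p) \<and> src \<Lambda> (x (p, q)) = x (q, q)) \<and>
     (\<forall>p q m. p \<le> q \<longrightarrow> q \<le> m \<longrightarrow> cmp \<Lambda> (x (p, q)) (x (q, m)) = x (p, m)))"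

definition shift :: "nat ^ 'k::finite \<Rightarrow> (((nat ^ 'k) \<times> (nat ^ 'k)) \<Rightarrow> 'p) \<Rightarrow> (((nat ^ 'k) \<times> (nat ^ 'k)) \<Rightarrow> 'p)" where
  "shift n x = (\<lambda>(p, q). if p \<le> q then x (p + n, q + n) else undefined)"

definition prepend :: "('p, 'k::finite) kgraph \<Rightarrow> 'p \<Rightarrow> (((nat ^ 'k) \<times> (nat ^ 'k)) \<Rightarrow> 'p)
    \<Rightarrow> (((nat ^ 'k) \<times> (nat ^ 'k)) \<Rightarrow> 'p)" where
  "prepend \<Lambda> \<mu> x = (THE y. y \<in> inf_paths \<Lambda> \<and> y (0, deg \<Lambda> \<mu>) = \<mu> \<and> shift (deg \<Lambda> \<mu>) y = x)"

definition self_similar :: "('p, 'k::finite) kgraph \<Rightarrow> ('g::group_add \<Rightarrow> 'p \<Rightarrow> 'p) \<Rightarrow> ('g \<Rightarrow> 'p \<Rightarrow> 'g) \<Rightarrow> bool" where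
  "self_similar \<Lambda> act res \<longleftrightarrow>
     (\<forall>g. bij_betw (act g) (Mor \<Lambda>) (Mor \<Lambda>) \<and>
        (\<forall>\<mu>\<in>Mor \<Lambda>. deg \<Lambda> (act g \<mu>) = deg \<Lambda> \<mu> \<and> rng \<Lambda> (act g \<mu>) = act g (rng \<Lambda> \<mu>) \<and>
                     src \<Lambda> (act g \<mu>) = act g (src \<Lambda> \<mu>))) \<and>
     (\<forall>\<mu>\<in>Mor \<Lambda>. act 0 \<mu> = \<mu>) \<and>
     (\<forall>g h. \<forall>\<mu>\<in>Mor \<Lambda>. act (g + h) \<mu> = act g (act h \<mu>)) \<and>
     (\<forall>g. \<forall>\<mu>\<in>Mor \<Lambda>. \<forall>\<nu>\<in>Mor \<Lambda>. src \<Lambda> \<mu> = rng \<Lambda> \<nu> \<longrightarrow>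
        act g (cmp \<Lambda> \<mu> \<nu>) = cmp \<Lambda> (act g \<mu>) (act (res g \<mu>) \<nu>) \<and>
        res g (cmp \<Lambda> \<mu> \<nu>) = res (res g \<mu>) \<nu>) \<and>
     (\<forall>g. \<forall>v\<in>verts \<Lambda>. res g v = g) \<and>
     (\<forall>\<mu>\<in>Mor \<Lambda>. res 0 \<mu> = 0) \<and>
     (\<forall>g h. \<forall>\<mu>\<in>Mor \<Lambda>. res (g + h) \<mu> = res g (act h \<mu>) + res h \<mu>)"

definition pseudo_free :: "('p, 'k::finite) kgraph \<Rightarrow> ('g::group_add \<Rightarrow> 'p \<Rightarrow> 'p) \<Rightarrow> ('g \<Rightarrow> 'p \<Rightarrow> 'g) \<Rightarrow> bool" where
  "pseudo_free \<Lambda> act res \<longleftrightarrow>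
     (\<forall>g. \<forall>\<mu>\<in>Mor \<Lambda>. act g \<mu> = \<mu> \<and> res g \<mu> = 0 \<longrightarrow> g = 0)"

definition locally_faithful :: "('p, 'k::finite) kgraph \<Rightarrow> ('g::group_add \<Rightarrow> 'p \<Rightarrow> 'p) \<Rightarrow> bool" where
  "locally_faithful \<Lambda> act \<longleftrightarrow>
     (\<forall>g. \<forall>v\<in>verts \<Lambda>. (\<forall>\<mu>\<in>Mor \<Lambda>. rng \<Lambda> \<mu> = v \<longrightarrow> act g \<mu> = \<mu>) \<longrightarrow> g = 0)"

definition finite_state :: "('p, 'k::finite) kgraph \<Rightarrow> ('g \<Rightarrow> 'p \<Rightarrow> 'g) \<Rightarrow> bool" where
  "finite_state \<Lambda> res \<longleftrightarrow> (\<forall>g. finite (res g ` Mor \<Lambda>))"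

definition path_act :: "('p, 'k::finite) kgraph \<Rightarrow> ('g \<Rightarrow> 'p \<Rightarrow> 'p) \<Rightarrow> ('g \<Rightarrow> 'p \<Rightarrow> 'g) \<Rightarrow> 'g
    \<Rightarrow> (((nat ^ 'k) \<times> (nat ^ 'k)) \<Rightarrow> 'p) \<Rightarrow> (((nat ^ 'k) \<times> (nat ^ 'k)) \<Rightarrow> 'p)" where
  "path_act \<Lambda> act res g x =
     (\<lambda>(p, q). if p \<le> q then act (res g (x (0, p))) (x (p, q)) else undefined)"

definition cycline :: "('p, 'k::finite) kgraph \<Rightarrow> ('g \<Rightarrow> 'p \<Rightarrow> 'p) \<Rightarrow> ('g \<Rightarrow> 'p \<Rightarrow> 'g) \<Rightarrow> ('p \<times> 'g \<times> 'p) set" where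
  "cycline \<Lambda> act res = {(\<mu>, g, \<nu>). \<mu> \<in> Mor \<Lambda> \<and> \<nu> \<in> Mor \<Lambda> \<and> src \<Lambda> \<mu> = act g (src \<Lambda> \<nu>) \<and>
      (\<forall>x\<in>inf_paths \<Lambda>. x (0, 0) = src \<Lambda> \<nu> \<longrightarrow>
          prepend \<Lambda> \<mu> (path_act \<Lambda> act res g x) = prepend \<Lambda> \<nu> x)}"

definition Tmat :: "('p, 'k::finite) kgraph \<Rightarrow> 'k \<Rightarrow> 'p \<Rightarrow> 'p \<Rightarrow> real" where
  "Tmat \<Lambda> i v w = real (card {e \<in> Mor \<Lambda>. deg \<Lambda> e = axis i 1 \<and> rng \<Lambda> e = v \<and> src \<Lambda> e = w})"

definition spec_rad :: "'v set \<Rightarrow> ('v \<Rightarrow> 'v \<Rightarrow> real) \<Rightarrow> real" where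
  "spec_rad V A = Max {cmod z | z. \<exists>x :: 'v \<Rightarrow> complex. (\<exists>v\<in>V. x v \<noteq> 0) \<and>
      (\<forall>v\<in>V. (\<Sum>w\<in>V. complex_of_real (A v w) * x w) = z * x v)}"

definition rho :: "('p, 'k::finite) kgraph \<Rightarrow> 'k \<Rightarrow> real" where
  "rho \<Lambda> i = spec_rad (verts \<Lambda>) (Tmat \<Lambda> i)"

definition rho_pow :: "('p, 'k::finite) kgraph \<Rightarrow> nat ^ 'k \<Rightarrow> real" where
  "rho_pow \<Lambda> n = (\<Prod>i\<in>UNIV. rho \<Lambda> i ^ (n $ i))"

definition pf_vec :: "('p, 'k::finite) kgraph \<Rightarrow> 'p \<Rightarrow> real" where
  "pf_vec \<Lambda> = (THE x. (\<forall>v\<in>verts \<Lambda>. x v > 0) \<and> (\<forall>v. v \<notin> verts \<Lambda> \<longrightarrow> x v = 0) \<and>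
      (\<Sum>v\<in>verts \<Lambda>. x v) = 1 \<and>
      (\<forall>i. \<forall>v\<in>verts \<Lambda>. (\<Sum>w\<in>verts \<Lambda>. Tmat \<Lambda> i v w * x w) = rho \<Lambda> i * x v))"

definition ck_family :: "('p, 'k::finite) kgraph \<Rightarrow> ('g::group_add \<Rightarrow> 'p \<Rightarrow> 'p) \<Rightarrow> ('g \<Rightarrow> 'p \<Rightarrow> 'g)
    \<Rightarrow> ('g \<Rightarrow> 'a::cstar_algebra) \<Rightarrow> ('p \<Rightarrow> 'a) \<Rightarrow> bool" where
  "ck_family \<Lambda> act res U S \<longleftrightarrow>
     (\<forall>g. cstar_adj (U g) * U g = 1 \<and> U g * cstar_adj (U g) = 1) \<and>
     (\<forall>v\<in>verts \<Lambda>. cstar_adj (S v) = S v \<and> S v * S v = S v) \<and>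
     (\<forall>v\<in>verts \<Lambda>. \<forall>w\<in>verts \<Lambda>. v \<noteq> w \<longrightarrow> S v * S w = 0) \<and>
     (\<forall>\<mu>\<in>Mor \<Lambda>. \<forall>\<nu>\<in>Mor \<Lambda>. src \<Lambda> \<mu> = rng \<Lambda> \<nu> \<longrightarrow> S (cmp \<Lambda> \<mu> \<nu>) = S \<mu> * S \<nu>) \<and>
     (\<forall>\<mu>\<in>Mor \<Lambda>. cstar_adj (S \<mu>) * S \<mu> = S (src \<Lambda> \<mu>)) \<and>
     (\<forall>v\<in>verts \<Lambda>. \<forall>n. S v = (\<Sum>\<mu>\<in>{\<mu> \<in> Mor \<Lambda>. rng \<Lambda> \<mu> = v \<and> deg \<Lambda> \<mu> = n}. S \<mu> * cstar_adj (S \<mu>))) \<and>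
     (\<forall>g h. U (g + h) = U g * U h) \<and>
     (\<forall>g. \<forall>\<mu>\<in>Mor \<Lambda>. U g * S \<mu> = S (act g \<mu>) * U (res g \<mu>))"

definition Vmn :: "('p, 'k::finite) kgraph \<Rightarrow> ('g \<Rightarrow> 'p \<Rightarrow> 'p) \<Rightarrow> ('g \<Rightarrow> 'p \<Rightarrow> 'g)
    \<Rightarrow> ('g \<Rightarrow> 'a::cstar_algebra) \<Rightarrow> ('p \<Rightarrow> 'a) \<Rightarrow> nat ^ 'k \<Rightarrow> nat ^ 'k \<Rightarrow> 'a" where
  "Vmn \<Lambda> act res U S m n =
     (\<Sum>(\<mu>, g, \<nu>)\<in>{t \<in> cycline \<Lambda> act res. deg \<Lambda> (fst t) = m \<and> deg \<Lambda> (snd (snd t)) = n}.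
        S \<mu> * U g * cstar_adj (S \<nu>))"

text \<open>KMS state (at inverse temperature 1 for the dynamics built from rho(Lambda)), in the
  equivalent form stated in the paper.\<close>

definition is_KMS :: "('p, 'k::finite) kgraph \<Rightarrow> ('g::group_add \<Rightarrow> 'p \<Rightarrow> 'p)
    \<Rightarrow> ('g \<Rightarrow> 'a::cstar_algebra) \<Rightarrow> ('p \<Rightarrow> 'a) \<Rightarrow> ('a \<Rightarrow> complex) \<Rightarrow> bool" where
  "is_KMS \<Lambda> act U S \<phi> \<longleftrightarrow> is_state \<phi> \<and>
     (\<forall>\<mu>\<in>Mor \<Lambda>. \<forall>\<nu>\<in>Mor \<Lambda>. \<forall>g y. src \<Lambda> \<mu> = act g (src \<Lambda> \<nu>) \<longrightarrow>
        \<phi> (S \<mu> * U g * cstar_adj (S \<nu>) * y) =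
        complex_of_real (rho_pow \<Lambda> (deg \<Lambda> \<nu>) / rho_pow \<Lambda> (deg \<Lambda> \<mu>)) *
          \<phi> (y * (S \<mu> * U g * cstar_adj (S \<nu>))))"

end

theory Submission
  imports Defs
begin

text \<open>
  Write \<open>T \<mu> g \<nu> = S \<mu> U g (S \<nu>)\<^sup>*\<close> and \<open>x v = \<phi> (S v)\<close>.  If \<open>x = 0\<close>, both sides vanish by the
  Cauchy-Schwarz inequality.  Otherwise the KMS condition forces \<open>\<rho> > 0\<close> and makes \<open>x\<close> a positive
  common eigenvector of the vertex matrices, so that \<open>x\<close> is a multiple of the Perron-Frobenius
  vector.

  Expanding \<open>T \<mu> g \<nu>\<close> along paths \<open>\<eta>\<close> of degree \<open>l\<close> gives the terms
  \<open>T (\<mu> (g \<cdot> \<eta>)) (g|\<eta>) (\<nu> \<eta>)\<close>; the KMS condition annihilates those whose outer paths have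
  different prefixes of degree \<open>l\<close> and divides the others by \<open>\<rho>\<^sup>l\<close> while removing the common
  prefix, which leads back to triples of the original degrees.

  For a non-cycline triple, only finitely many triples arise in this way, all of them non-cycline,
  and some term is annihilated: a maximum argument shows that \<open>\<phi> (T \<mu> g \<nu>) = 0\<close>.  For cycline
  triples, \<open>\<mu>\<close> and the degree of \<open>\<nu>\<close> determine \<open>g\<close> and \<open>\<nu>\<close>, and by strong connectivity every
  \<open>\<mu>\<close> of the given degree occurs.  Summing \<open>\<phi> (T \<mu> g \<nu>)\<close> over \<open>\<mu>\<close> with range \<open>v\<close> therefore
  yields again a common eigenvector, which must be \<open>\<phi> (V\<^sub>m\<^sub>n)\<close> times the Perron-Frobenius vector.
\<close>

section \<open>Paths and prefixes\<close>

lemma ex1_implies_eq: "\<exists>!x. P x \<Longrightarrow> P a \<Longrightarrow> P b \<Longrightarrow> a = b"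
  by blast

lemma le_add_vec_nat: "(a::nat^'k::finite) \<le> a + b"
  by (simp add: less_eq_vec_def)

lemma add_left_mono_vec_nat: "(a + b \<le> a + c) = (b \<le> (c::nat^'k::finite))"
  by (simp add: less_eq_vec_def)

lemma add_diff_vec_nat: "a \<le> b \<Longrightarrow> a + (b - a) = (b::nat^'k::finite)"
  by (simp add: less_eq_vec_def vec_eq_iff)

lemma zero_le_vec_nat: "(0::nat^'k::finite) \<le> a"
  by (simp add: less_eq_vec_def)

text \<open>Constant vectors are cofinal among the degrees, so a chain of paths indexed by natural
  numbers can reach every degree.\<close>

lemma le_vec_sum: "(a::nat^'k::finite) \<le> vec (\<Sum>i\<in>UNIV. a $ i)"
  by (simp add: less_eq_vec_def member_le_sum)

locale kgr =
  fixes \<Lambda> :: "('p, 'k::finite) kgraph"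
  assumes kgraph: "is_kgraph \<Lambda>"
begin

abbreviation comp :: "'p \<Rightarrow> 'p \<Rightarrow> 'p" (infixl "\<odot>" 75) where "\<mu> \<odot> \<nu> \<equiv> cmp \<Lambda> \<mu> \<nu>"
abbreviation "M \<equiv> Mor \<Lambda>"
abbreviation "s \<equiv> src \<Lambda>"
abbreviation "r \<equiv> rng \<Lambda>"
abbreviation "d \<equiv> deg \<Lambda>"

definition paths :: "'p \<Rightarrow> nat^'k \<Rightarrow> 'p set" where
  "paths v n = {\<mu> \<in> M. r \<mu> = v \<and> d \<mu> = n}"

text \<open>The prefix order does the work of infinite paths: a path has exactly one prefix of each
  degree below its own, so agreement of infinite paths can be tested by common prefixes.\<close>

definition pre :: "'p \<Rightarrow> 'p \<Rightarrow> bool" where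
  "pre \<alpha> \<beta> \<longleftrightarrow> \<alpha> \<in> M \<and> (\<exists>\<gamma>\<in>M. s \<alpha> = r \<gamma> \<and> \<beta> = \<alpha> \<odot> \<gamma>)"

section \<open>Category axioms and unique factorization\<close>

lemma vertsD: "v \<in> verts \<Lambda> \<Longrightarrow> v \<in> M \<and> d v = 0 \<and> r v = v \<and> s v = v"
  using kgraph by (auto simp: is_kgraph_def verts_def)

lemma r_verts [simp]: "\<mu> \<in> M \<Longrightarrow> r \<mu> \<in> verts \<Lambda>"
  and s_verts [simp]: "\<mu> \<in> M \<Longrightarrow> s \<mu> \<in> verts \<Lambda>"
  using kgraph by (auto simp: is_kgraph_def)

lemma rs_simps [simp]:
  assumes "\<mu> \<in> M"
  shows "r \<mu> \<in> M" "s \<mu> \<in> M" "d (r \<mu>) = 0" "d (s \<mu>) = 0"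
    "r (r \<mu>) = r \<mu>" "s (r \<mu>) = r \<mu>" "r (s \<mu>) = s \<mu>" "s (s \<mu>) = s \<mu>"
  using assms r_verts s_verts vertsD by blast+

lemma comp_id [simp]: "\<mu> \<in> M \<Longrightarrow> r \<mu> \<odot> \<mu> = \<mu>" "\<mu> \<in> M \<Longrightarrow> \<mu> \<odot> s \<mu> = \<mu>"
  using kgraph by (auto simp: is_kgraph_def)

lemma comp_simps [simp]:
  assumes "\<mu> \<in> M" "\<nu> \<in> M" "s \<mu> = r \<nu>"
  shows "\<mu> \<odot> \<nu> \<in> M" "r (\<mu> \<odot> \<nu>) = r \<mu>" "s (\<mu> \<odot> \<nu>) = s \<nu>" "d (\<mu> \<odot> \<nu>) = d \<mu> + d \<nu>"
  using kgraph assms by (auto simp: is_kgraph_def)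

lemma comp_assoc:
  assumes "\<mu> \<in> M" "\<nu> \<in> M" "\<kappa> \<in> M" "s \<mu> = r \<nu>" "s \<nu> = r \<kappa>"
  shows "\<mu> \<odot> \<nu> \<odot> \<kappa> = \<mu> \<odot> (\<nu> \<odot> \<kappa>)"
  using kgraph assms by (auto simp: is_kgraph_def)

lemma factor_ex1:
  assumes "\<mu> \<in> M" "d \<mu> = m + n"
  shows "\<exists>!(\<alpha>, \<beta>). \<alpha> \<in> M \<and> \<beta> \<in> M \<and> s \<alpha> = r \<beta> \<and> d \<alpha> = m \<and> d \<beta> = n \<and> \<mu> = \<alpha> \<odot> \<beta>"
  using kgraph assms unfolding is_kgraph_def by blast

lemma factorE:
  assumes "\<mu> \<in> M" "d \<mu> = m + n"
  obtains \<alpha> \<beta> where "\<alpha> \<in> M" "\<beta> \<in> M" "s \<alpha> = r \<beta>" "d \<alpha> = m" "d \<beta> = n" "\<mu> = \<alpha> \<odot> \<beta>"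
  using factor_ex1[OF assms] by auto

text \<open>The degrees of the second factors agree by cancellation, so both pairs factor the same
  path at the same degrees.\<close>

lemma comp_cancel:
  assumes "\<alpha> \<in> M" "\<beta> \<in> M" "s \<alpha> = r \<beta>" "\<alpha>' \<in> M" "\<beta>' \<in> M" "s \<alpha>' = r \<beta>'"
    and eq: "\<alpha> \<odot> \<beta> = \<alpha>' \<odot> \<beta>'" and deg: "d \<alpha> = d \<alpha>'"
  shows "\<alpha> = \<alpha>'" "\<beta> = \<beta>'"
proof -
  have d\<beta>: "d \<beta>' = d \<beta>" using assms comp_simps(4) add_left_cancel by metis
  have "\<alpha> \<odot> \<beta> \<in> M" "d (\<alpha> \<odot> \<beta>) = d \<alpha> + d \<beta>" using assms(1-3) by simp_all
  from factor_ex1[OF this] have "(\<alpha>, \<beta>) = (\<alpha>', \<beta>')"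
    by (rule ex1_implies_eq) (use assms d\<beta> in simp_all)
  then show "\<alpha> = \<alpha>'" "\<beta> = \<beta>'" by auto
qed

section \<open>The prefix order on finite paths\<close>

lemma preI: "\<alpha> \<in> M \<Longrightarrow> \<gamma> \<in> M \<Longrightarrow> s \<alpha> = r \<gamma> \<Longrightarrow> pre \<alpha> (\<alpha> \<odot> \<gamma>)"
  by (auto simp: pre_def)

lemma preE:
  assumes "pre \<alpha> \<beta>"
  obtains \<gamma> where "\<alpha> \<in> M" "\<gamma> \<in> M" "s \<alpha> = r \<gamma>" "\<beta> = \<alpha> \<odot> \<gamma>"
  using assms by (auto simp: pre_def)

lemma preD:
  assumes "pre \<alpha> \<beta>"
  shows "\<alpha> \<in> M" "\<beta> \<in> M" "r \<alpha> = r \<beta>" "d \<alpha> \<le> d \<beta>"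
  using assms by (auto elim!: preE simp: le_add_vec_nat)

lemma pre_refl: "\<alpha> \<in> M \<Longrightarrow> pre \<alpha> \<alpha>"
  using preI[of \<alpha> "s \<alpha>"] by simp

lemma pre_trans:
  assumes "pre \<alpha> \<beta>" "pre \<beta> \<gamma>"
  shows "pre \<alpha> \<gamma>"
proof -
  obtain \<delta> \<epsilon> where "\<alpha> \<in> M" "\<delta> \<in> M" "s \<alpha> = r \<delta>" "\<beta> = \<alpha> \<odot> \<delta>" "\<epsilon> \<in> M" "s \<beta> = r \<epsilon>" "\<gamma> = \<beta> \<odot> \<epsilon>"
    using assms by (auto elim!: preE)
  then have "\<gamma> = \<alpha> \<odot> (\<delta> \<odot> \<epsilon>)" "\<delta> \<odot> \<epsilon> \<in> M" "r (\<delta> \<odot> \<epsilon>) = s \<alpha>"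
    by (simp_all add: comp_assoc)
  then show ?thesis using \<open>\<alpha> \<in> M\<close> by (metis preI)
qed

lemma pre_ex:
  assumes "\<beta> \<in> M" "N \<le> d \<beta>"
  shows "\<exists>\<alpha>. pre \<alpha> \<beta> \<and> d \<alpha> = N"
proof -
  have "d \<beta> = N + (d \<beta> - N)" using assms by (simp add: add_diff_vec_nat)
  from factorE[OF assms(1) this] show ?thesis by (metis preI)
qed

lemma pre_unique:
  assumes "pre \<alpha> \<gamma>" "pre \<beta> \<gamma>" "d \<alpha> = d \<beta>"
  shows "\<alpha> = \<beta>"
  using assms comp_cancel(1) by (auto elim!: preE)

text \<open>Degrees are only partially ordered, so prefixes of one path are comparable just when
  their degrees are. Cutting \<open>\<beta>\<close> at degree \<open>d \<alpha>\<close> gives a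
  prefix of \<open>\<gamma>\<close>, which can only be \<open>\<alpha>\<close>.\<close>

lemma pre_linear:
  assumes "pre \<alpha> \<gamma>" "pre \<beta> \<gamma>" "d \<alpha> \<le> d \<beta>"
  shows "pre \<alpha> \<beta>"
proof -
  obtain \<alpha>' where "pre \<alpha>' \<beta>" "d \<alpha>' = d \<alpha>" using pre_ex assms preD by metis
  then show ?thesis using assms pre_trans pre_unique by metis
qed

lemma pre_comp_cancel:
  assumes "\<alpha> \<in> M" "\<beta> \<in> M" "\<gamma> \<in> M" "s \<alpha> = r \<beta>" "s \<alpha> = r \<gamma>"
  shows "pre (\<alpha> \<odot> \<beta>) (\<alpha> \<odot> \<gamma>) = pre \<beta> \<gamma>"
proof
  assume "pre (\<alpha> \<odot> \<beta>) (\<alpha> \<odot> \<gamma>)"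
  then obtain \<delta> where \<delta>: "\<delta> \<in> M" "s \<beta> = r \<delta>" "\<alpha> \<odot> \<gamma> = \<alpha> \<odot> \<beta> \<odot> \<delta>"
    using assms by (auto elim!: preE)
  then have "\<alpha> \<odot> \<gamma> = \<alpha> \<odot> (\<beta> \<odot> \<delta>)" using assms by (simp add: comp_assoc)
  then have "\<gamma> = \<beta> \<odot> \<delta>" using assms \<delta> comp_cancel(2)[of \<alpha> \<gamma> \<alpha> "\<beta> \<odot> \<delta>"] by simp
  then show "pre \<beta> \<gamma>" using \<delta> assms by (simp add: preI)
next
  assume "pre \<beta> \<gamma>"
  then obtain \<delta> where \<delta>: "\<delta> \<in> M" "s \<beta> = r \<delta>" "\<gamma> = \<beta> \<odot> \<delta>"
    by (auto elim!: preE)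
  then show "pre (\<alpha> \<odot> \<beta>) (\<alpha> \<odot> \<gamma>)"
    using assms preI[of "\<alpha> \<odot> \<beta>" \<delta>] by (simp add: comp_assoc)
qed

lemma pre_comp_factor:
  assumes "pre \<tau> (\<alpha> \<odot> \<gamma>)" "\<alpha> \<in> M" "\<gamma> \<in> M" "s \<alpha> = r \<gamma>" "d \<tau> = d \<alpha> + n"
  obtains \<tau>' where "pre \<tau>' \<gamma>" "d \<tau>' = n" "\<tau> = \<alpha> \<odot> \<tau>'" "s \<alpha> = r \<tau>'"
proof -
  have "pre \<alpha> \<tau>" using assms pre_linear[OF preI assms(1)] by (simp add: le_add_vec_nat)
  then obtain \<tau>' where t: "\<tau>' \<in> M" "s \<alpha> = r \<tau>'" "\<tau> = \<alpha> \<odot> \<tau>'" by (auto elim!: preE)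
  then have "pre \<tau>' \<gamma>"
    using assms pre_comp_cancel[of \<alpha> \<tau>' \<gamma>] by metis
  moreover have "d \<alpha> + d \<tau>' = d \<alpha> + n"
    using t assms(2,5) by (metis comp_simps(4))
  then have "d \<tau>' = n" by simp
  ultimately show ?thesis using t by (intro that)
qed

text \<open>Unique factorization as a bijection with composable pairs. It is later applied to both
  splittings \<open>m + l\<close> and \<open>l + m\<close> of one total degree.\<close>

lemma sum_paths_add:
  fixes f :: "'p \<Rightarrow> 'b::comm_monoid_add"
  assumes fin: "\<And>v n. finite (paths v n)"
  shows "(\<Sum>\<beta>\<in>paths v (m + n). f \<beta>) = (\<Sum>\<alpha>\<in>paths v m. \<Sum>\<eta>\<in>paths (s \<alpha>) n. f (\<alpha> \<odot> \<eta>))"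
proof -
  have "bij_betw (\<lambda>(\<alpha>, \<eta>). \<alpha> \<odot> \<eta>) (SIGMA \<alpha>:paths v m. paths (s \<alpha>) n) (paths v (m + n))"
  proof (rule bij_betw_imageI)
    have cancel: "\<alpha> = \<alpha>' \<and> \<eta> = \<eta>'"
      if "\<alpha> \<in> paths v m" "\<eta> \<in> paths (s \<alpha>) n" "\<alpha>' \<in> paths v m" "\<eta>' \<in> paths (s \<alpha>') n"
        "\<alpha> \<odot> \<eta> = \<alpha>' \<odot> \<eta>'" for \<alpha> \<eta> \<alpha>' \<eta>'
      using that comp_cancel[of \<alpha> \<eta> \<alpha>' \<eta>'] by (simp only: paths_def mem_Collect_eq)
    show "inj_on (\<lambda>(\<alpha>, \<eta>). \<alpha> \<odot> \<eta>) (SIGMA \<alpha>:paths v m. paths (s \<alpha>) n)"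
      unfolding inj_on_def by (auto dest: cancel)
    show "(\<lambda>(\<alpha>, \<eta>). \<alpha> \<odot> \<eta>) ` (SIGMA \<alpha>:paths v m. paths (s \<alpha>) n) = paths v (m + n)"
    proof (intro equalityI subsetI)
      fix \<beta> assume "\<beta> \<in> (\<lambda>(\<alpha>, \<eta>). \<alpha> \<odot> \<eta>) ` (SIGMA \<alpha>:paths v m. paths (s \<alpha>) n)"
      then obtain \<alpha> \<eta> where "\<alpha> \<in> paths v m" "\<eta> \<in> paths (s \<alpha>) n" "\<beta> = \<alpha> \<odot> \<eta>"
        by auto
      then show "\<beta> \<in> paths v (m + n)" by (simp add: paths_def)
    next
      fix \<beta> assume "\<beta> \<in> paths v (m + n)"
      then have "\<beta> \<in> M" "d \<beta> = m + n" "r \<beta> = v" by (simp_all add: paths_def)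
      from factorE[OF this(1,2)] obtain \<alpha> \<eta> where f:
        "\<alpha> \<in> M" "\<eta> \<in> M" "s \<alpha> = r \<eta>" "d \<alpha> = m" "d \<eta> = n" "\<beta> = \<alpha> \<odot> \<eta>" .
      then have "(\<alpha>, \<eta>) \<in> (SIGMA \<alpha>:paths v m. paths (s \<alpha>) n)"
        using \<open>r \<beta> = v\<close> by (simp add: paths_def)
      then show "\<beta> \<in> (\<lambda>(\<alpha>, \<eta>). \<alpha> \<odot> \<eta>) ` (SIGMA \<alpha>:paths v m. paths (s \<alpha>) n)"
        using f(6) by (intro image_eqI[of _ _ "(\<alpha>, \<eta>)"]) simp_all
    qed
  qed
  then have "(\<Sum>\<beta>\<in>paths v (m + n). f \<beta>) =
      (\<Sum>(\<alpha>, \<eta>)\<in>(SIGMA \<alpha>:paths v m. paths (s \<alpha>) n). f (\<alpha> \<odot> \<eta>))"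
    by (simp add: sum.reindex_bij_betw[symmetric] case_prod_unfold)
  then show ?thesis using fin by (simp add: sum.Sigma)
qed

section \<open>Infinite paths\<close>

lemma infD:
  assumes "x \<in> inf_paths \<Lambda>"
  shows "\<not> p \<le> q \<Longrightarrow> x (p, q) = undefined"
    "p \<le> q \<Longrightarrow> x (p, q) \<in> M" "p \<le> q \<Longrightarrow> d (x (p, q)) = q - p"
    "p \<le> q \<Longrightarrow> r (x (p, q)) = x (p, p)" "p \<le> q \<Longrightarrow> s (x (p, q)) = x (q, q)"
    "p \<le> q \<Longrightarrow> q \<le> m \<Longrightarrow> x (p, q) \<odot> x (q, m) = x (p, m)"
  using assms by (auto simp: inf_paths_def)

lemma inf_prefix:
  assumes "x \<in> inf_paths \<Lambda>"
  shows "x (0, N) \<in> M" "d (x (0, N)) = N" "r (x (0, N)) = x (0, 0)"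
  using infD[OF assms, of 0 N] by (auto simp: zero_le_vec_nat vec_eq_iff)

lemma inf_pre:
  assumes "x \<in> inf_paths \<Lambda>" "N \<le> K"
  shows "pre (x (0, N)) (x (0, K))"
  using infD[OF assms(1), of 0 N] infD[OF assms(1), of N K] infD(6)[OF assms(1), of 0 N K] assms
    zero_le_vec_nat unfolding pre_def by metis

text \<open>Agreement at arbitrarily large degrees passes down to all initial segments by uniqueness
  of prefixes; \<open>x (p, q)\<close> is then recovered by cancelling \<open>x (0, p)\<close> from
  \<open>x (0, q)\<close>.\<close>

lemma inf_eqI:
  assumes x: "x \<in> inf_paths \<Lambda>" and y: "y \<in> inf_paths \<Lambda>"
    and ex: "\<And>N. \<exists>K\<ge>N. x (0, K) = y (0, K)"
  shows "x = y"
proof -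
  have *: "x (0, N) = y (0, N)" for N
    using ex[of N] pre_unique inf_pre[OF x] inf_pre[OF y] inf_prefix(2)[OF x] inf_prefix(2)[OF y]
    by metis
  have "x (p, q) = y (p, q)" for p q
  proof (cases "p \<le> q")
    case True
    have "x (p, p) = y (p, p)"
      using *[of p] infD(5)[OF x zero_le_vec_nat] infD(5)[OF y zero_le_vec_nat] by metis
    moreover have "x (0, p) \<odot> x (p, q) = y (0, p) \<odot> y (p, q)"
      using *[of q] infD(6)[OF x zero_le_vec_nat True] infD(6)[OF y zero_le_vec_nat True]
      by metis
    ultimately show ?thesis
      using infD(2-4)[OF x True] infD(2-4)[OF y True] infD(5)[OF x zero_le_vec_nat]
        infD(5)[OF y zero_le_vec_nat] infD(2)[OF x zero_le_vec_nat]
        infD(2)[OF y zero_le_vec_nat] *[of p] comp_cancel(2)[of "x (0, p)" "x (p, q)" "y (0, p)" "y (p, q)"]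
      by metis
  qed (simp add: infD[OF x] infD[OF y])
  then show ?thesis by auto
qed

text \<open>Every degree \<open>N\<close> lies below that of some \<open>f j\<close>, and the prefix
  of degree \<open>N\<close> does not depend on the choice of \<open>j\<close>. The segment from
  \<open>p\<close> to \<open>q\<close> is the quotient of two such prefixes.\<close>

lemma inf_path_of_chain:
  fixes f :: "nat \<Rightarrow> 'p"
  assumes step: "\<And>j. pre (f j) (f (Suc j))" and deg: "\<And>j. vec j \<le> d (f j)"
  shows "\<exists>x\<in>inf_paths \<Lambda>. \<forall>j. x (0, d (f j)) = f j"
proof -
  have fM: "f j \<in> M" for j using step preD by blast
  have mono: "pre (f i) (f j)" if "i \<le> j" for i j
    using that by (induction rule: dec_induct) (auto simp: fM pre_refl intro: pre_trans step)
  have "\<exists>\<kappa>. d \<kappa> = N \<and> (\<exists>j. pre \<kappa> (f j))" for N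
    using pre_ex[OF fM] deg le_vec_sum[of N] by (meson order_trans)
  then obtain c where c: "\<And>N. d (c N) = N" "\<And>N. \<exists>j. pre (c N) (f j)" by metis
  have cpre: "pre (c N) (c K)" if "N \<le> K" for N K
  proof -
    obtain i j where "pre (c N) (f i)" "pre (c K) (f j)" using c by blast
    then have "pre (c N) (f (max i j))" "pre (c K) (f (max i j))"
      using mono pre_trans max.cobounded1 max.cobounded2 by metis+
    then show ?thesis using pre_linear c that by metis
  qed
  have cf: "c (d (f j)) = f j" for j
  proof -
    obtain i where "pre (c (d (f j))) (f i)" using c by blast
    then have "pre (c (d (f j))) (f (max i j))" "pre (f j) (f (max i j))"
      using mono pre_trans max.cobounded1 max.cobounded2 by metis+
    then show ?thesis using pre_unique c by metis
  qed
  have "\<forall>p q. \<exists>\<gamma>. p \<le> q \<longrightarrow> \<gamma> \<in> M \<and> s (c p) = r \<gamma> \<and> c q = c p \<odot> \<gamma>"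
    using cpre by (auto simp: pre_def)
  then obtain \<gamma> where \<gamma>: "\<And>p q. p \<le> q \<Longrightarrow> \<gamma> p q \<in> M \<and> s (c p) = r (\<gamma> p q) \<and> c q = c p \<odot> \<gamma> p q"
    by metis
  have cM: "c p \<in> M" for p using cpre preD by blast
  have deg\<gamma>: "d (\<gamma> p q) = q - p" if "p \<le> q" for p q
  proof -
    have "d (c q) = d (c p) + d (\<gamma> p q)" using \<gamma>[OF that] cM by simp
    then show ?thesis using c(1) by (simp add: vec_eq_iff)
  qed
  have diag: "\<gamma> p p = s (c p)" for p
    using \<gamma>[of p p] cM[of p] comp_cancel(2)[of "c p" "\<gamma> p p" "c p" "s (c p)"] comp_id(2) rs_simps
    by (metis order_refl)
  have src: "s (\<gamma> p q) = \<gamma> q q" if "p \<le> q" for p q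
    using \<gamma>[OF that] cM[of p] by (simp add: diag)
  have cmp: "\<gamma> p q \<odot> \<gamma> q m = \<gamma> p m" if "p \<le> q" "q \<le> m" for p q m
  proof -
    have pm: "p \<le> m" using that by (rule order_trans)
    have g: "\<gamma> p q \<in> M" "\<gamma> q m \<in> M" "s (\<gamma> p q) = r (\<gamma> q m)" "s (c p) = r (\<gamma> p q)"
      using \<gamma>[OF that(1)] \<gamma>[OF that(2)] src[OF that(1)] diag by metis+
    have "c p \<odot> (\<gamma> p q \<odot> \<gamma> q m) = c p \<odot> \<gamma> p m"
      using \<gamma>[OF that(1)] \<gamma>[OF that(2)] \<gamma>[OF pm] g cM by (metis comp_assoc)
    then show ?thesis
      using \<gamma>[OF pm] g cM comp_simps(1,2)[OF g(1-3)]
        comp_cancel(2)[of "c p" "\<gamma> p q \<odot> \<gamma> q m" "c p" "\<gamma> p m"] by metis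
  qed
  have rng: "r (\<gamma> p q) = \<gamma> p p" if "p \<le> q" for p q
    using \<gamma>[OF that] diag by metis
  define x where "x = (\<lambda>(p, q). if p \<le> q then \<gamma> p q else undefined)"
  have x: "x \<in> inf_paths \<Lambda>"
    unfolding inf_paths_def mem_Collect_eq
  proof (intro conjI allI impI)
    fix p q m :: "nat^'k" assume "p \<le> q" "q \<le> m"
    moreover then have "p \<le> m" by (rule order_trans)
    ultimately show "x (p, q) \<odot> x (q, m) = x (p, m)" by (simp add: x_def cmp)
  qed (simp_all add: x_def \<gamma> deg\<gamma> rng src)
  \<comment> \<open>By construction \<open>x (0, N)\<close> is the quotient of \<open>c N\<close> by
    \<open>c 0\<close>; the latter has degree 0, so it is a vertex and composes as an
    identity.\<close>
  have "x (0, N) = c N" for N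
  proof -
    have "c N = c 0 \<odot> x (0, N)" "s (c 0) = r (x (0,N))" "x (0,N) \<in> M"
      using \<gamma>[of 0 N] by (auto simp: x_def zero_le_vec_nat)
    moreover have "c 0 \<in> verts \<Lambda>" using c(1)[of 0] cM by (simp add: verts_def)
    ultimately show ?thesis using vertsD comp_id(1) by metis
  qed
  then show ?thesis using x cf by metis
qed

text \<open>The definite description in \<open>prepend\<close> denotes: the chain of
  \<open>\<mu> \<odot> x (0, vec j)\<close> gives existence, and any two candidates share their
  initial segments.\<close>

lemma prepend:
  assumes x: "x \<in> inf_paths \<Lambda>" and \<mu>: "\<mu> \<in> M" and v: "x (0, 0) = s \<mu>"
  shows "prepend \<Lambda> \<mu> x \<in> inf_paths \<Lambda>" "prepend \<Lambda> \<mu> x (0, d \<mu> + N) = \<mu> \<odot> x (0, N)"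
proof -
  let ?P = "\<lambda>y. y \<in> inf_paths \<Lambda> \<and> y (0, d \<mu>) = \<mu> \<and> shift (d \<mu>) y = x"
  have pref: "y (0, d \<mu> + N) = \<mu> \<odot> x (0, N)" if "?P y" for y N
  proof -
    have "x (0, N) = y (d \<mu>, d \<mu> + N)"
      using that by (auto simp: shift_def zero_le_vec_nat add.commute)
    then show ?thesis
      using that infD(6)[of y 0 "d \<mu>" "d \<mu> + N"] by (simp add: zero_le_vec_nat le_add_vec_nat)
  qed
  have ex_ge: "\<exists>K\<ge>N. \<exists>L. K = d \<mu> + L" for N
    by (metis add.commute le_add_vec_nat)
  have "\<exists>y. ?P y"
  proof -
    let ?f = "\<lambda>j. \<mu> \<odot> x (0, vec j)"
    have "pre (?f j) (?f (Suc j))" for j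
      using pre_comp_cancel \<mu> v inf_prefix[OF x] inf_pre[OF x, of "vec j" "vec (Suc j)"]
      by (simp add: less_eq_vec_def)
    moreover have df: "d (?f j) = d \<mu> + vec j" for j
      using \<mu> v inf_prefix[OF x] by simp
    moreover have "vec j \<le> d (?f j)" for j
      using df[of j] by (metis add.commute le_add_vec_nat)
    ultimately obtain y where y: "y \<in> inf_paths \<Lambda>" and yf: "\<And>j. y (0, d \<mu> + vec j) = ?f j"
      using inf_path_of_chain[of ?f] by auto
    have yN: "y (0, d \<mu> + N) = \<mu> \<odot> x (0, N)" for N
    proof -
      obtain j where j: "N \<le> vec j" using le_vec_sum by blast
      have "pre (y (0, d \<mu> + N)) (?f j)"
        using inf_pre[OF y, of "d \<mu> + N" "d \<mu> + vec j"] j yf by (simp add: add_left_mono_vec_nat)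
      moreover have "pre (\<mu> \<odot> x (0, N)) (?f j)"
        using j pre_comp_cancel \<mu> v inf_prefix[OF x] inf_pre[OF x] by simp
      ultimately show ?thesis
        using pre_unique \<mu> v inf_prefix[OF x] inf_prefix[OF y] by simp
    qed
    have y\<mu>: "y (0, d \<mu>) = \<mu>" using yN[of 0] v \<mu> by simp
    have sh: "shift (d \<mu>) y \<in> inf_paths \<Lambda>"
    proof -
      have le: "p + d \<mu> \<le> q + d \<mu> \<longleftrightarrow> p \<le> q" for p q by (simp add: less_eq_vec_def)
      have "q + d \<mu> - (p + d \<mu>) = q - p" for p q :: "nat^'k" by (simp add: vec_eq_iff)
      then show ?thesis
        using infD[OF y] by (auto simp: inf_paths_def shift_def le)
    qed
    have "shift (d \<mu>) y = x"
    proof (rule inf_eqI[OF sh x])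
      fix N
      have "shift (d \<mu>) y (0, N) = y (d \<mu>, d \<mu> + N)"
        by (simp add: shift_def zero_le_vec_nat add.commute)
      also have "\<dots> = x (0, N)"
        by (rule comp_cancel(2)[of \<mu> _ \<mu>])
          (use y\<mu> yN infD[OF y, of "d \<mu>" "d \<mu> + N"] infD(5)[OF y, of 0 "d \<mu>"]
             infD(6)[OF y, of 0 "d \<mu>" "d \<mu> + N"] \<mu> v inf_prefix[OF x]
            in \<open>simp_all add: zero_le_vec_nat le_add_vec_nat\<close>)
      finally show "\<exists>K\<ge>N. shift (d \<mu>) y (0, K) = x (0, K)" by auto
    qed
    then show ?thesis using y y\<mu> by auto
  qed
  then obtain y where y: "?P y" ..
  have uniq: "y = z" if "?P y" "?P z" for y z
    using that ex_ge pref by (intro inf_eqI) metis+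
  have "?P (prepend \<Lambda> \<mu> x)"
    unfolding prepend_def by (rule theI[of ?P y]) (rule y, rule uniq[OF _ y])
  then show "prepend \<Lambda> \<mu> x \<in> inf_paths \<Lambda>" "prepend \<Lambda> \<mu> x (0, d \<mu> + N) = \<mu> \<odot> x (0, N)"
    using pref by auto
qed

text \<open>A path whose degree is 1 in every coordinate is appended at each step, so the degrees
  outgrow all constant vectors.\<close>

lemma extend_to_inf_path:
  assumes sf: "source_free \<Lambda>" and \<eta>: "\<eta> \<in> M"
  shows "\<exists>x\<in>inf_paths \<Lambda>. x (0, d \<eta>) = \<eta>"
proof -
  have "\<forall>v. \<exists>\<epsilon>. v \<in> verts \<Lambda> \<longrightarrow> \<epsilon> \<in> M \<and> r \<epsilon> = v \<and> d \<epsilon> = vec 1"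
    using sf by (auto simp: source_free_def)
  then obtain \<epsilon> where \<epsilon>: "\<And>v. v \<in> verts \<Lambda> \<Longrightarrow> \<epsilon> v \<in> M \<and> r (\<epsilon> v) = v \<and> d (\<epsilon> v) = vec 1" by metis
  define f where "f = rec_nat \<eta> (\<lambda>_ \<kappa>. \<kappa> \<odot> \<epsilon> (s \<kappa>))"
  have f0: "f 0 = \<eta>" and fS: "f (Suc j) = f j \<odot> \<epsilon> (s (f j))" for j by (simp_all add: f_def)
  have fM: "f j \<in> M" for j
    by (induction j) (simp_all add: f0 fS \<eta> \<epsilon>)
  have "vec j \<le> d (f j)" for j
    by (induction j) (simp_all add: fS fM \<epsilon> less_eq_vec_def)
  moreover have "pre (f j) (f (Suc j))" for j
    unfolding fS by (intro preI) (simp_all add: fM \<epsilon>)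
  ultimately show ?thesis using inf_path_of_chain[of f] f0 by metis
qed

end

section \<open>Cycline triples in terms of finite paths\<close>

text \<open>The last assumption makes \<open>act g \<mu> \<odot> act (res g \<mu>) \<nu>\<close> composable; since
  composition is a total function, this does not follow from \<open>self_similar\<close> alone.\<close>

locale selfsim = kgr \<Lambda> for \<Lambda> :: "('p, 'k::finite) kgraph" +
  fixes act :: "'g::group_add \<Rightarrow> 'p \<Rightarrow> 'p" and res :: "'g \<Rightarrow> 'p \<Rightarrow> 'g"
  assumes self_similar: "self_similar \<Lambda> act res"
    and source_free: "source_free \<Lambda>"
    and act_res_src: "\<mu> \<in> M \<Longrightarrow> act (res g \<mu>) (s \<mu>) = act g (s \<mu>)"
begin

section \<open>Rules for the action and the restriction\<close>

lemma act_simps [simp]: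
  assumes "\<mu> \<in> M"
  shows "act g \<mu> \<in> M" "d (act g \<mu>) = d \<mu>" "r (act g \<mu>) = act g (r \<mu>)" "s (act g \<mu>) = act g (s \<mu>)"
    "act 0 \<mu> = \<mu>" "act (g + h) \<mu> = act g (act h \<mu>)" "res 0 \<mu> = 0"
    "res (g + h) \<mu> = res g (act h \<mu>) + res h \<mu>"
  using self_similar assms unfolding self_similar_def by (auto dest: bij_betwE)

lemma act_inv [simp]:
  assumes "\<mu> \<in> M"
  shows "act (- g) (act g \<mu>) = \<mu>" "act g (act (- g) \<mu>) = \<mu>"
  using assms act_simps(5,6) by (metis left_minus, metis right_minus)

lemma act_eq_iff:
  assumes "\<mu> \<in> M" "\<nu> \<in> M"
  shows "act g \<mu> = act g \<nu> \<longleftrightarrow> \<mu> = \<nu>"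
  using assms act_inv(1) by metis

lemma res_vert [simp]: "v \<in> verts \<Lambda> \<Longrightarrow> res g v = g"
  using self_similar unfolding self_similar_def by auto

lemma act_comp:
  assumes "\<mu> \<in> M" "\<nu> \<in> M" "s \<mu> = r \<nu>"
  shows "act g (\<mu> \<odot> \<nu>) = act g \<mu> \<odot> act (res g \<mu>) \<nu>" "res g (\<mu> \<odot> \<nu>) = res (res g \<mu>) \<nu>"
    "s (act g \<mu>) = r (act (res g \<mu>) \<nu>)"
proof -
  show "act g (\<mu> \<odot> \<nu>) = act g \<mu> \<odot> act (res g \<mu>) \<nu>" "res g (\<mu> \<odot> \<nu>) = res (res g \<mu>) \<nu>"
    using self_similar assms unfolding self_similar_def by blast+
  show "s (act g \<mu>) = r (act (res g \<mu>) \<nu>)"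
    using assms act_res_src act_simps(3,4) by metis
qed

lemma act_pre:
  assumes "pre \<alpha> \<beta>"
  shows "pre (act g \<alpha>) (act g \<beta>)"
proof -
  obtain \<gamma> where g: "\<alpha> \<in> M" "\<gamma> \<in> M" "s \<alpha> = r \<gamma>" "\<beta> = \<alpha> \<odot> \<gamma>" using assms by (rule preE)
  show ?thesis unfolding g(4) act_comp(1)[OF g(1-3)]
    using g(1,2) act_comp(3)[OF g(1-3)] by (intro preI) simp_all
qed

lemma extensionE:
  assumes "\<eta> \<in> M"
  obtains \<epsilon> where "\<epsilon> \<in> M" "s \<eta> = r \<epsilon>" "d \<epsilon> = n"
  using source_free s_verts[OF assms] unfolding source_free_def by metis

text \<open>\<open>\<mu> (g \<cdot> x) = \<nu> x\<close> for all infinite paths \<open>x\<close>, tested on finite initial segments of \<open>x\<close>.\<close>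

definition cyc :: "'p \<Rightarrow> 'g \<Rightarrow> 'p \<Rightarrow> bool" where
  "cyc \<mu> g \<nu> \<longleftrightarrow> \<mu> \<in> M \<and> \<nu> \<in> M \<and> s \<mu> = act g (s \<nu>) \<and>
     (\<forall>\<eta>\<in>M. r \<eta> = s \<nu> \<longrightarrow> (\<exists>\<kappa>. d \<kappa> = d \<eta> \<and> pre \<kappa> (\<mu> \<odot> act g \<eta>) \<and> pre \<kappa> (\<nu> \<odot> \<eta>)))"

text \<open>The pieces fit because restricting along \<open>x (0, q)\<close> is restricting along
  \<open>x (0, p)\<close> and then along \<open>x (p, q)\<close>. An initial segment only sees the
  restriction along a vertex, which is \<open>g\<close> itself.\<close>

lemma path_act:
  assumes x: "x \<in> inf_paths \<Lambda>"
  shows "path_act \<Lambda> act res g x \<in> inf_paths \<Lambda>" "path_act \<Lambda> act res g x (0, N) = act g (x (0, N))"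
proof -
  have v: "x (p, p) \<in> verts \<Lambda>" for p
    using infD(2,3)[OF x, of p p] by (simp add: verts_def vec_eq_iff)
  show "path_act \<Lambda> act res g x (0, N) = act g (x (0, N))"
    by (simp add: path_act_def zero_le_vec_nat v)
  have step: "act (res g (x (0, p))) (x (p, q)) \<odot> act (res g (x (0, q))) (x (q, m)) =
        act (res g (x (0, p))) (x (p, m))"
    and src: "act (res g (x (0, p))) (s (x (p, q))) = act (res g (x (0, q))) (x (q, q))"
    if "p \<le> q" "q \<le> m" for p q m
  proof -
    have *: "x (0, p) \<in> M" "x (p, q) \<in> M" "s (x (0, p)) = r (x (p, q))"
      "x (0, p) \<odot> x (p, q) = x (0, q)" "s (x (p, q)) = x (q, q)"
      "x (q, m) \<in> M" "s (x (p, q)) = r (x (q, m))" "x (p, q) \<odot> x (q, m) = x (p, m)"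
      using infD[OF x] that zero_le_vec_nat by metis+
    have "res g (x (0, q)) = res (res g (x (0, p))) (x (p, q))"
      using act_comp(2)[OF *(1-3)] *(4) by metis
    then show "act (res g (x (0, p))) (x (p, q)) \<odot> act (res g (x (0, q))) (x (q, m)) =
        act (res g (x (0, p))) (x (p, m))"
      "act (res g (x (0, p))) (s (x (p, q))) = act (res g (x (0, q))) (x (q, q))"
      using act_comp(1)[OF *(2,6,7)] *(8) act_res_src[OF *(2)] *(5) by metis+
  qed
  show "path_act \<Lambda> act res g x \<in> inf_paths \<Lambda>"
    unfolding inf_paths_def mem_Collect_eq
  proof (intro conjI allI impI)
    fix p q m :: "nat^'k" assume "p \<le> q" "q \<le> m"
    moreover then have "p \<le> m" by (rule order_trans)
    ultimately show "path_act \<Lambda> act res g x (p, q) \<odot> path_act \<Lambda> act res g x (q, m) =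
        path_act \<Lambda> act res g x (p, m)"
      by (simp add: path_act_def step)
  next
    fix p q :: "nat^'k" assume "p \<le> q"
    then show "s (path_act \<Lambda> act res g x (p, q)) = path_act \<Lambda> act res g x (q, q)"
      using src[of p q q] infD(2)[OF x, of p q] by (simp add: path_act_def)
  qed (simp_all add: path_act_def infD[OF x])
qed

text \<open>The segments \<open>x (0, N)\<close> are the test paths, and without sources every
  finite path is such a segment. Prepending only increases degrees, so
  \<open>\<mu> \<odot> act g (x (0, N))\<close> already shows the first \<open>N\<close> steps of
  the infinite path.\<close>

lemma cycline_iff: "(\<mu>, g, \<nu>) \<in> cycline \<Lambda> act res \<longleftrightarrow> cyc \<mu> g \<nu>"
proof (cases "\<mu> \<in> M \<and> \<nu> \<in> M \<and> s \<mu> = act g (s \<nu>)")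
  case True
  then have \<mu>: "\<mu> \<in> M" and \<nu>: "\<nu> \<in> M" and s: "s \<mu> = act g (s \<nu>)" by auto
  let ?z = "\<lambda>x. prepend \<Lambda> \<mu> (path_act \<Lambda> act res g x)" and ?y = "\<lambda>x. prepend \<Lambda> \<nu> x"
  have z: "?z x \<in> inf_paths \<Lambda>" "pre (?z x (0, N)) (\<mu> \<odot> act g (x (0, N)))"
    "?y x \<in> inf_paths \<Lambda>" "pre (?y x (0, N)) (\<nu> \<odot> x (0, N))"
    if x: "x \<in> inf_paths \<Lambda>" and v: "x (0, 0) = s \<nu>" for x N
  proof -
    have v': "path_act \<Lambda> act res g x (0, 0) = s \<mu>" using path_act(2)[OF x] v s by simp
    note z = prepend[OF path_act(1)[OF x] \<mu> v'] and y = prepend[OF x \<nu> v]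
    have le: "N \<le> b + N" for b :: "nat^'k" by (metis add.commute le_add_vec_nat)
    show "?z x \<in> inf_paths \<Lambda>" "?y x \<in> inf_paths \<Lambda>" using z y by auto
    show "pre (?z x (0, N)) (\<mu> \<odot> act g (x (0, N)))"
      using inf_pre[OF z(1) le] z(2) path_act(2)[OF x] by metis
    show "pre (?y x (0, N)) (\<nu> \<odot> x (0, N))"
      using inf_pre[OF y(1) le] y(2) by metis
  qed
  show ?thesis
  proof
    assume L: "(\<mu>, g, \<nu>) \<in> cycline \<Lambda> act res"
    show "cyc \<mu> g \<nu>" unfolding cyc_def
    proof (intro conjI ballI impI)
      fix \<eta> assume \<eta>: "\<eta> \<in> M" "r \<eta> = s \<nu>"
      obtain x where x: "x \<in> inf_paths \<Lambda>" "x (0, d \<eta>) = \<eta>"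
        using extend_to_inf_path[OF source_free \<eta>(1)] by blast
      have v: "x (0, 0) = s \<nu>" using inf_prefix(3)[OF x(1)] x(2) \<eta>(2) by metis
      have "?z x = ?y x" using L x(1) v unfolding cycline_def by blast
      then show "\<exists>\<kappa>. d \<kappa> = d \<eta> \<and> pre \<kappa> (\<mu> \<odot> act g \<eta>) \<and> pre \<kappa> (\<nu> \<odot> \<eta>)"
        using z[OF x(1) v] x(2) inf_prefix(2) by metis
    qed (use True in auto)
  next
    assume R: "cyc \<mu> g \<nu>"
    have "?z x = ?y x" if x: "x \<in> inf_paths \<Lambda>" and v: "x (0, 0) = s \<nu>" for x
    proof (rule inf_eqI[OF z(1,3)[OF x v]])
      fix N
      have "x (0, N) \<in> M" "r (x (0, N)) = s \<nu>" "d (x (0, N)) = N"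
        using inf_prefix[OF x] v by auto
      then obtain \<kappa> where "d \<kappa> = N" "pre \<kappa> (\<mu> \<odot> act g (x (0, N)))" "pre \<kappa> (\<nu> \<odot> x (0, N))"
        using R unfolding cyc_def by metis
      then have "?z x (0, N) = ?y x (0, N)"
        using z[OF x v] inf_prefix(2) pre_unique by metis
      then show "\<exists>K\<ge>N. ?z x (0, K) = ?y x (0, K)" by blast
    qed
    then show "(\<mu>, g, \<nu>) \<in> cycline \<Lambda> act res" using True unfolding cycline_def by auto
  qed
qed (auto simp: cycline_def cyc_def)

section \<open>Transfer of prefixes and stability of cycline triples\<close>

lemma cycD:
  assumes "cyc \<mu> g \<nu>"
  shows "\<mu> \<in> M" "\<nu> \<in> M" "s \<mu> = act g (s \<nu>)"
  using assms by (auto simp: cyc_def)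

text \<open>The definition of \<open>cyc\<close> yields a common prefix of degree
  \<open>d \<eta>\<close> only. Testing on a longer path gives one as large as desired, at the price
  of passing to extensions \<open>A\<close> and \<open>B\<close> of the two composites.\<close>

lemma cyc_common_extension:
  assumes "cyc \<mu> g \<nu>" "\<eta> \<in> M" "r \<eta> = s \<nu>"
  obtains \<kappa> A B where "N \<le> d \<kappa>" "pre \<kappa> A" "pre \<kappa> B" "pre (\<mu> \<odot> act g \<eta>) A" "pre (\<nu> \<odot> \<eta>) B"
proof -
  note c = cycD[OF assms(1)]
  obtain \<epsilon> where e: "\<epsilon> \<in> M" "s \<eta> = r \<epsilon>" "d \<epsilon> = N" using extensionE[OF assms(2)] .
  have "\<eta> \<odot> \<epsilon> \<in> M" "r (\<eta> \<odot> \<epsilon>) = s \<nu>" "d (\<eta> \<odot> \<epsilon>) = d \<eta> + N" using e assms by simp_all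
  then obtain \<kappa> where k: "d \<kappa> = d \<eta> + N" "pre \<kappa> (\<mu> \<odot> act g (\<eta> \<odot> \<epsilon>))" "pre \<kappa> (\<nu> \<odot> (\<eta> \<odot> \<epsilon>))"
    using assms(1) unfolding cyc_def by metis
  have s: "s \<mu> = r (act g \<eta>)" using c assms by simp
  have p: "pre (act g \<eta>) (act g (\<eta> \<odot> \<epsilon>))" "pre \<eta> (\<eta> \<odot> \<epsilon>)"
    using act_pre preI[OF assms(2) e(1,2)] by auto
  have "pre (\<mu> \<odot> act g \<eta>) (\<mu> \<odot> act g (\<eta> \<odot> \<epsilon>))"
    using pre_comp_cancel[OF c(1) preD(1,2)[OF p(1)]] p(1) s preD(3)[OF p(1)] by simp
  moreover have "pre (\<nu> \<odot> \<eta>) (\<nu> \<odot> (\<eta> \<odot> \<epsilon>))"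
    using pre_comp_cancel[OF c(2) preD(1,2)[OF p(2)]] p(2) assms(3) preD(3)[OF p(2)] by simp
  moreover have "N \<le> d \<kappa>" using k(1) by (metis add.commute le_add_vec_nat)
  ultimately show ?thesis using that k by blast
qed

text \<open>Both composites are initial segments of one infinite path, so a prefix of one is a
  prefix of the other as soon as its degree fits. Formally, \<open>\<alpha>\<close> is compared with
  a common prefix \<open>\<kappa>\<close> of larger degree.\<close>

lemma cyc_pre:
  assumes "cyc \<mu> g \<nu>" "\<eta> \<in> M" "r \<eta> = s \<nu>"
  shows "pre \<alpha> (\<mu> \<odot> act g \<eta>) \<Longrightarrow> d \<alpha> \<le> d \<nu> + d \<eta> \<Longrightarrow> pre \<alpha> (\<nu> \<odot> \<eta>)"
    and "pre \<alpha> (\<nu> \<odot> \<eta>) \<Longrightarrow> d \<alpha> \<le> d \<mu> + d \<eta> \<Longrightarrow> pre \<alpha> (\<mu> \<odot> act g \<eta>)"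
proof -
  obtain \<kappa> A B where k: "d \<alpha> \<le> d \<kappa>" "pre \<kappa> A" "pre \<kappa> B" "pre (\<mu> \<odot> act g \<eta>) A" "pre (\<nu> \<odot> \<eta>) B"
    using cyc_common_extension[OF assms] .
  note c = cycD[OF assms(1)]
  have d: "d (\<mu> \<odot> act g \<eta>) = d \<mu> + d \<eta>" "d (\<nu> \<odot> \<eta>) = d \<nu> + d \<eta>" using c assms(2,3) by simp_all
  show "pre \<alpha> (\<nu> \<odot> \<eta>)" if "pre \<alpha> (\<mu> \<odot> act g \<eta>)" "d \<alpha> \<le> d \<nu> + d \<eta>"
    using that k d pre_trans pre_linear by metis
  show "pre \<alpha> (\<mu> \<odot> act g \<eta>)" if "pre \<alpha> (\<nu> \<odot> \<eta>)" "d \<alpha> \<le> d \<mu> + d \<eta>"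
    using that k d pre_trans pre_linear by metis
qed

lemma cycI:
  assumes "\<mu> \<in> M" "\<nu> \<in> M" "s \<mu> = act g (s \<nu>)"
    and "\<And>\<eta>. \<eta> \<in> M \<Longrightarrow> r \<eta> = s \<nu> \<Longrightarrow> \<exists>\<kappa>. d \<eta> \<le> d \<kappa> \<and> pre \<kappa> (\<mu> \<odot> act g \<eta>) \<and> pre \<kappa> (\<nu> \<odot> \<eta>)"
  shows "cyc \<mu> g \<nu>"
  unfolding cyc_def
proof (intro conjI ballI impI)
  fix \<eta> assume "\<eta> \<in> M" "r \<eta> = s \<nu>"
  then obtain \<kappa> where k: "d \<eta> \<le> d \<kappa>" "pre \<kappa> (\<mu> \<odot> act g \<eta>)" "pre \<kappa> (\<nu> \<odot> \<eta>)" using assms(4) by blast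
  then obtain \<kappa>' where "pre \<kappa>' \<kappa>" "d \<kappa>' = d \<eta>" using pre_ex preD(1) by metis
  then show "\<exists>\<kappa>. d \<kappa> = d \<eta> \<and> pre \<kappa> (\<mu> \<odot> act g \<eta>) \<and> pre \<kappa> (\<nu> \<odot> \<eta>)" using k pre_trans by blast
qed (use assms in auto)

text \<open>Testing on the vertex \<open>s \<nu>\<close> gives a common prefix, and a prefix has the
  range of the whole path.\<close>

lemma cyc_rng_eq:
  assumes "cyc \<mu> g \<nu>"
  shows "r \<mu> = r \<nu>"
proof -
  have n: "\<nu> \<in> M" "s \<nu> \<in> M" "r (s \<nu>) = s \<nu>" using cycD(2)[OF assms] by simp_all
  then obtain \<kappa> where "pre \<kappa> (\<mu> \<odot> act g (s \<nu>))" "pre \<kappa> (\<nu> \<odot> s \<nu>)"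
    using assms unfolding cyc_def by metis
  then show ?thesis using preD(3) cycD[OF assms] comp_id(2) by metis
qed

text \<open>A test path \<open>\<zeta>\<close> for the extended triple is the test path
  \<open>\<eta> \<odot> \<zeta>\<close> for the original one.\<close>

lemma cyc_comp_right:
  assumes "cyc \<mu> g \<nu>" "\<eta> \<in> M" "r \<eta> = s \<nu>"
  shows "cyc (\<mu> \<odot> act g \<eta>) (res g \<eta>) (\<nu> \<odot> \<eta>)"
proof (rule cycI)
  note c = cycD[OF assms(1)]
  have s: "s \<mu> = r (act g \<eta>)" using c assms by simp
  show m: "\<mu> \<odot> act g \<eta> \<in> M" "\<nu> \<odot> \<eta> \<in> M" using c s assms by simp_all
  show "s (\<mu> \<odot> act g \<eta>) = act (res g \<eta>) (s (\<nu> \<odot> \<eta>))"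
    using c s assms by (simp add: act_res_src)
  fix \<zeta> assume z: "\<zeta> \<in> M" "r \<zeta> = s (\<nu> \<odot> \<eta>)"
  then have z2: "s \<eta> = r \<zeta>" using c assms by simp
  have "\<eta> \<odot> \<zeta> \<in> M" "r (\<eta> \<odot> \<zeta>) = s \<nu>" "d (\<eta> \<odot> \<zeta>) = d \<eta> + d \<zeta>" using z z2 assms by simp_all
  then obtain \<kappa> where k: "d \<kappa> = d \<eta> + d \<zeta>" "pre \<kappa> (\<mu> \<odot> act g (\<eta> \<odot> \<zeta>))" "pre \<kappa> (\<nu> \<odot> (\<eta> \<odot> \<zeta>))"
    using assms(1) unfolding cyc_def by metis
  note a = act_comp[OF assms(2) z(1) z2]
  have "\<mu> \<odot> act g (\<eta> \<odot> \<zeta>) = \<mu> \<odot> act g \<eta> \<odot> act (res g \<eta>) \<zeta>"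
    unfolding a(1) by (rule comp_assoc[symmetric]) (use c s a(3) assms z in simp_all)
  moreover have "\<nu> \<odot> (\<eta> \<odot> \<zeta>) = \<nu> \<odot> \<eta> \<odot> \<zeta>"
    by (rule comp_assoc[symmetric]) (use c assms z z2 in simp_all)
  moreover have "d \<zeta> \<le> d \<kappa>" using k(1) by (metis add.commute le_add_vec_nat)
  ultimately show "\<exists>\<kappa>. d \<zeta> \<le> d \<kappa> \<and> pre \<kappa> (\<mu> \<odot> act g \<eta> \<odot> act (res g \<eta>) \<zeta>) \<and> pre \<kappa> (\<nu> \<odot> \<eta> \<odot> \<zeta>)"
    using k by metis
qed

text \<open>Prepending and cancelling a common prefix \<open>\<alpha>\<close>. For cancellation the
  prefix to be transferred has degree \<open>d \<alpha> + d \<eta>\<close>, beyond what the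
  definition of \<open>cyc\<close> offers, so \<open>cyc_pre\<close> is used.\<close>

lemma cyc_comp_left:
  assumes "\<alpha> \<in> M" "\<mu> \<in> M" "\<nu> \<in> M" "s \<alpha> = r \<mu>" "s \<alpha> = r \<nu>"
  shows "cyc (\<alpha> \<odot> \<mu>) g (\<alpha> \<odot> \<nu>) \<longleftrightarrow> cyc \<mu> g \<nu>"
proof -
  have sm: "s (\<alpha> \<odot> \<mu>) = s \<mu>" "s (\<alpha> \<odot> \<nu>) = s \<nu>" using assms by simp_all
  have assoc: "\<alpha> \<odot> \<mu> \<odot> act g \<eta> = \<alpha> \<odot> (\<mu> \<odot> act g \<eta>)" "\<alpha> \<odot> \<nu> \<odot> \<eta> = \<alpha> \<odot> (\<nu> \<odot> \<eta>)"
    and m: "\<mu> \<odot> act g \<eta> \<in> M" "\<nu> \<odot> \<eta> \<in> M" "s \<alpha> = r (\<mu> \<odot> act g \<eta>)" "s \<alpha> = r (\<nu> \<odot> \<eta>)"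
      "d (\<mu> \<odot> act g \<eta>) = d \<mu> + d \<eta>"
    if "\<eta> \<in> M" "r \<eta> = s \<nu>" "s \<mu> = act g (s \<nu>)" for \<eta>
  proof -
    have "s \<mu> = r (act g \<eta>)" "s \<nu> = r \<eta>" using that by simp_all
    note * = this
    show "\<alpha> \<odot> \<mu> \<odot> act g \<eta> = \<alpha> \<odot> (\<mu> \<odot> act g \<eta>)" "\<alpha> \<odot> \<nu> \<odot> \<eta> = \<alpha> \<odot> (\<nu> \<odot> \<eta>)"
      using * assms that(1) comp_assoc act_simps(1) by metis+
    show "\<mu> \<odot> act g \<eta> \<in> M" "\<nu> \<odot> \<eta> \<in> M" "s \<alpha> = r (\<mu> \<odot> act g \<eta>)" "s \<alpha> = r (\<nu> \<odot> \<eta>)"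
      "d (\<mu> \<odot> act g \<eta>) = d \<mu> + d \<eta>"
      using * assms that(1) comp_simps act_simps(1,2) by metis+
  qed
  show ?thesis
  proof
    assume L: "cyc (\<alpha> \<odot> \<mu>) g (\<alpha> \<odot> \<nu>)"
    have s: "s \<mu> = act g (s \<nu>)" using cycD(3)[OF L] sm by simp
    show "cyc \<mu> g \<nu>"
    proof (rule cycI[OF assms(2,3) s])
      fix \<eta> assume \<eta>: "\<eta> \<in> M" "r \<eta> = s \<nu>"
      note mm = m[OF \<eta> s] and as = assoc[OF \<eta> s]
      obtain \<kappa> where k: "pre \<kappa> (\<mu> \<odot> act g \<eta>)" "d \<kappa> = d \<eta>"
        using pre_ex[OF mm(1), of "d \<eta>"] mm(5) by (metis add.commute le_add_vec_nat)
      have kM: "\<kappa> \<in> M" "s \<alpha> = r \<kappa>" using preD(1,3)[OF k(1)] mm(3) by simp_all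
      have "pre (\<alpha> \<odot> \<kappa>) (\<alpha> \<odot> \<mu> \<odot> act g \<eta>)"
        using k(1) as(1) pre_comp_cancel[OF assms(1) kM(1) mm(1) kM(2) mm(3)] by simp
      moreover have "d (\<alpha> \<odot> \<kappa>) \<le> d (\<alpha> \<odot> \<nu>) + d \<eta>"
        using assms kM k(2) by (simp add: less_eq_vec_def)
      ultimately have "pre (\<alpha> \<odot> \<kappa>) (\<alpha> \<odot> \<nu> \<odot> \<eta>)"
        using cyc_pre(1)[OF L \<eta>(1)] \<eta>(2) sm(2) by metis
      then have "pre \<kappa> (\<nu> \<odot> \<eta>)"
        using as(2) pre_comp_cancel[OF assms(1) kM(1) mm(2) kM(2) mm(4)] by simp
      then show "\<exists>\<kappa>. d \<eta> \<le> d \<kappa> \<and> pre \<kappa> (\<mu> \<odot> act g \<eta>) \<and> pre \<kappa> (\<nu> \<odot> \<eta>)"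
        using k by (metis order_refl)
    qed
  next
    assume R: "cyc \<mu> g \<nu>"
    have s: "s \<mu> = act g (s \<nu>)" using cycD(3)[OF R] .
    show "cyc (\<alpha> \<odot> \<mu>) g (\<alpha> \<odot> \<nu>)"
    proof (rule cycI)
      show "\<alpha> \<odot> \<mu> \<in> M" "\<alpha> \<odot> \<nu> \<in> M" using assms by simp_all
      show "s (\<alpha> \<odot> \<mu>) = act g (s (\<alpha> \<odot> \<nu>))" using sm s by simp
      fix \<eta> assume \<eta>: "\<eta> \<in> M" "r \<eta> = s (\<alpha> \<odot> \<nu>)"
      then have \<eta>2: "r \<eta> = s \<nu>" using sm by simp
      note mm = m[OF \<eta>(1) \<eta>2 s] and as = assoc[OF \<eta>(1) \<eta>2 s]
      obtain \<kappa> where k: "d \<kappa> = d \<eta>" "pre \<kappa> (\<mu> \<odot> act g \<eta>)" "pre \<kappa> (\<nu> \<odot> \<eta>)"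
        using R \<eta>(1) \<eta>2 unfolding cyc_def by blast
      have kM: "\<kappa> \<in> M" "s \<alpha> = r \<kappa>" using preD(1,3)[OF k(2)] mm(3) by simp_all
      have "pre (\<alpha> \<odot> \<kappa>) (\<alpha> \<odot> \<mu> \<odot> act g \<eta>)"
        using k(2) as(1) pre_comp_cancel[OF assms(1) kM(1) mm(1) kM(2) mm(3)] by simp
      moreover have "pre (\<alpha> \<odot> \<kappa>) (\<alpha> \<odot> \<nu> \<odot> \<eta>)"
        using k(3) as(2) pre_comp_cancel[OF assms(1) kM(1) mm(2) kM(2) mm(4)] by simp
      moreover have "d \<eta> \<le> d (\<alpha> \<odot> \<kappa>)"
        using assms(1) kM k(1) by (simp add: less_eq_vec_def)
      ultimately show "\<exists>\<kappa>. d \<eta> \<le> d \<kappa> \<and> pre \<kappa> (\<alpha> \<odot> \<mu> \<odot> act g \<eta>) \<and> pre \<kappa> (\<alpha> \<odot> \<nu> \<odot> \<eta>)" by blast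
    qed
  qed
qed

text \<open>If \<open>\<mu>\<^sub>0 (g\<^sub>0 \<cdot> x) = \<nu>\<^sub>0 x\<close> for all \<open>x\<close>, apply this to \<open>x = \<eta> \<mu> y\<close> and remove the prefix
  \<open>\<mu>\<^sub>0 (g\<^sub>0 \<cdot> \<eta>)\<close>: since \<open>\<mu>\<close> and \<open>\<mu>\<^sub>0\<close> have the same degree, \<open>\<nu>\<^sub>0 \<eta> \<mu>\<close> already determines the
  prefix of \<open>\<mu> y\<close> of degree \<open>d \<nu>\<^sub>0\<close>, independently of \<open>y\<close>.\<close>

lemma cyc_same_degree:
  assumes sc: "strongly_connected \<Lambda>" and c0: "cyc \<mu>0 g0 \<nu>0" and \<mu>: "\<mu> \<in> M" "d \<mu> = d \<mu>0"
  shows "\<exists>g \<nu>. cyc \<mu> g \<nu> \<and> d \<nu> = d \<nu>0"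
proof -
  note c = cycD[OF c0]
  obtain \<eta> where \<eta>: "\<eta> \<in> M" "r \<eta> = s \<nu>0" "s \<eta> = r \<mu>"
    using sc s_verts[OF c(2)] r_verts[OF \<mu>(1)] unfolding strongly_connected_def by blast
  define h where "h = res g0 \<eta>"
  define a where "a = \<mu>0 \<odot> act g0 \<eta>"
  have sa0: "s \<mu>0 = r (act g0 \<eta>)" using c \<eta> by simp
  have a: "a \<in> M" "d a = d \<mu>0 + d \<eta>" "s a = act h (s \<eta>)"
    using c(1) \<eta>(1) sa0 act_res_src[OF \<eta>(1)] by (simp_all add: a_def h_def)
  have split: "\<mu>0 \<odot> act g0 (\<eta> \<odot> \<zeta>) = a \<odot> act h \<zeta>" "s a = r (act h \<zeta>)"
    if "\<zeta> \<in> M" "s \<eta> = r \<zeta>" for \<zeta>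
  proof -
    note ac = act_comp[OF \<eta>(1) that, of g0]
    show "\<mu>0 \<odot> act g0 (\<eta> \<odot> \<zeta>) = a \<odot> act h \<zeta>"
      unfolding ac(1) a_def h_def
      by (rule comp_assoc[symmetric]) (use c(1) \<eta>(1) that(1) sa0 ac(3) in simp_all)
    show "s a = r (act h \<zeta>)" using a(3) that by simp
  qed
  have \<eta>\<mu>: "\<eta> \<odot> \<mu> \<in> M" "r (\<eta> \<odot> \<mu>) = s \<nu>0" "d (\<eta> \<odot> \<mu>) = d \<eta> + d \<mu>" "s (\<eta> \<odot> \<mu>) = s \<mu>"
    using \<eta> \<mu> by simp_all
  have N: "\<nu>0 \<odot> (\<eta> \<odot> \<mu>) \<in> M" "d (\<nu>0 \<odot> (\<eta> \<odot> \<mu>)) = d \<nu>0 + (d \<eta> + d \<mu>)" "s (\<nu>0 \<odot> (\<eta> \<odot> \<mu>)) = s \<mu>"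
    using c(2) \<eta>\<mu> by simp_all
  \<comment> \<open>There is room for \<open>a\<close> on the other side, since its degree
    \<open>d \<mu>0 + d \<eta>\<close> is that of \<open>\<eta> \<odot> \<mu>\<close>.\<close>
  have "pre a (\<mu>0 \<odot> act g0 (\<eta> \<odot> \<mu>))"
    unfolding split(1)[OF \<mu>(1) \<eta>(3)]
    using preI[OF a(1) _ split(2)[OF \<mu>(1) \<eta>(3)]] \<mu>(1) by simp
  moreover have "d a \<le> d \<nu>0 + d (\<eta> \<odot> \<mu>)"
    unfolding a \<eta>\<mu> \<mu>(2) by (simp add: less_eq_vec_def)
  ultimately have "pre a (\<nu>0 \<odot> (\<eta> \<odot> \<mu>))" by (rule cyc_pre(1)[OF c0 \<eta>\<mu>(1,2)])
  then obtain \<beta> where \<beta>: "\<beta> \<in> M" "s a = r \<beta>" "\<nu>0 \<odot> (\<eta> \<odot> \<mu>) = a \<odot> \<beta>" by (auto elim: preE)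
  have "d \<nu>0 + (d \<eta> + d \<mu>) = d a + d \<beta>"
    using N(2) \<beta> a(1) comp_simps(4) by metis
  then have d\<beta>: "d \<beta> = d \<nu>0" unfolding a(2) \<mu>(2) by (simp add: vec_eq_iff)
  have s\<beta>: "s \<beta> = s \<mu>" using N(3) \<beta> a(1) comp_simps(3) by metis
  \<comment> \<open>On infinite continuations \<open>y\<close>, removing \<open>a\<close> leaves the
    equation of h \<cdot> (\<mu> y) and \<beta> y. Translation by \<open>- h\<close> exhibits
    \<open>\<nu>\<close> as the partner of \<open>\<mu>\<close>, with group element
    \<open>res h \<nu>\<close>.\<close>
  define \<nu> where "\<nu> = act (- h) \<beta>"
  have \<nu>: "\<nu> \<in> M" "act h \<nu> = \<beta>" "d \<nu> = d \<nu>0" using \<beta>(1) d\<beta> by (simp_all add: \<nu>_def)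
  define k where "k = res h \<nu>"
  have "s \<mu> = act h (s \<nu>)" using s\<beta> \<nu> act_simps(4) by metis
  then have s\<mu>: "s \<mu> = act k (s \<nu>)" using act_res_src[OF \<nu>(1)] by (simp add: k_def)
  have r\<nu>: "r \<nu> = r \<mu>"
  proof -
    have "act h (r \<nu>) = act h (r \<mu>)" using \<beta>(2) a(3) \<eta>(3) \<nu> act_simps(3) by metis
    then show ?thesis using act_eq_iff \<nu>(1) \<mu>(1) by simp
  qed
  have "cyc \<mu> k \<nu>"
  proof (rule cycI[OF \<mu>(1) \<nu>(1) s\<mu>])
    fix y' assume y': "y' \<in> M" "r y' = s \<nu>"
    define y where "y = act k y'"
    have y: "y \<in> M" "s \<mu> = r y" "d y = d y'" using y' s\<mu> by (simp_all add: y_def)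
    have \<mu>y: "\<mu> \<odot> y \<in> M" "s \<eta> = r (\<mu> \<odot> y)" "d (\<mu> \<odot> y) = d \<mu> + d y'" using \<mu> y \<eta>(3) by simp_all
    have \<nu>y: "\<nu> \<odot> y' \<in> M" "d (\<nu> \<odot> y') = d \<nu>0 + d y'" "r (\<nu> \<odot> y') = s \<eta>"
      using \<nu>(1,3) y' r\<nu> \<eta>(3) by simp_all
    have \<eta>\<mu>y: "\<eta> \<odot> (\<mu> \<odot> y) \<in> M" "r (\<eta> \<odot> (\<mu> \<odot> y)) = s \<nu>0" "d (\<eta> \<odot> (\<mu> \<odot> y)) = d \<eta> + (d \<mu> + d y')"
      using \<mu>y \<eta>(1,2) by simp_all
    have "\<nu>0 \<odot> (\<eta> \<odot> (\<mu> \<odot> y)) = \<nu>0 \<odot> (\<eta> \<odot> \<mu> \<odot> y)"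
      using comp_assoc[OF \<eta>(1) \<mu>(1) y(1) \<eta>(3) y(2)] by simp
    also have "\<dots> = \<nu>0 \<odot> (\<eta> \<odot> \<mu>) \<odot> y"
      by (rule comp_assoc[symmetric]) (use c(2) \<eta>\<mu> y in simp_all)
    also have "\<dots> = a \<odot> (\<beta> \<odot> y)"
      unfolding \<beta>(3) using comp_assoc[OF a(1) \<beta>(1) y(1) \<beta>(2)] s\<beta> y(2) by simp
    also have "\<beta> \<odot> y = act h (\<nu> \<odot> y')"
      using act_comp(1)[OF \<nu>(1) y'(1)] y'(2) \<nu>(2) by (simp add: y_def k_def)
    finally have eq: "\<nu>0 \<odot> (\<eta> \<odot> (\<mu> \<odot> y)) = a \<odot> act h (\<nu> \<odot> y')" .
    have ra: "s a = r (act h (\<nu> \<odot> y'))" using a(3) \<nu>y by simp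
    have "d (a \<odot> act h (\<nu> \<odot> y')) = d a + (d \<nu>0 + d y')" "a \<odot> act h (\<nu> \<odot> y') \<in> M"
      using a(1) \<nu>y ra by simp_all
    moreover have "d a + d y' \<le> d a + (d \<nu>0 + d y')" by (simp add: less_eq_vec_def)
    \<comment> \<open>The prefix exceeding \<open>a\<close> by \<open>d y'\<close> is carried over
      by the cycline relation; removing \<open>a\<close> and translating by \<open>- h\<close>
      leaves the common prefix of degree \<open>d y'\<close>.\<close>
    ultimately obtain \<tau> where \<tau>: "pre \<tau> (a \<odot> act h (\<nu> \<odot> y'))" "d \<tau> = d a + d y'"
      using pre_ex by metis
    have "d \<tau> \<le> d \<mu>0 + d (\<eta> \<odot> (\<mu> \<odot> y))" unfolding \<tau> a \<eta>\<mu>y by (simp add: less_eq_vec_def)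
    with \<tau>(1) have t2: "pre \<tau> (a \<odot> act h (\<mu> \<odot> y))"
      using cyc_pre(2)[OF c0 \<eta>\<mu>y(1,2), of \<tau>] unfolding eq split(1)[OF \<mu>y(1,2)] by simp
    obtain \<tau>' where \<tau>': "pre \<tau>' (act h (\<nu> \<odot> y'))" "d \<tau>' = d y'" "\<tau> = a \<odot> \<tau>'" "s a = r \<tau>'"
      using pre_comp_factor[OF \<tau>(1) a(1) _ ra \<tau>(2)] \<nu>y(1) by (metis act_simps(1))
    have \<tau>'M: "\<tau>' \<in> M" using preD(1)[OF \<tau>'(1)] .
    have t3: "pre \<tau>' (act h (\<mu> \<odot> y))"
      using t2 pre_comp_cancel[OF a(1) \<tau>'M _ \<tau>'(4) split(2)[OF \<mu>y(1,2)]] \<mu>y(1)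
      unfolding \<tau>'(3) by simp
    have "pre (act (- h) \<tau>') (\<mu> \<odot> y)" using act_pre[OF t3, of "- h"] \<mu>y(1) by simp
    moreover have "pre (act (- h) \<tau>') (\<nu> \<odot> y')" using act_pre[OF \<tau>'(1), of "- h"] \<nu>y(1) by simp
    moreover have "d y' \<le> d (act (- h) \<tau>')" using \<tau>'M \<tau>'(2) by simp
    ultimately show "\<exists>\<kappa>. d y' \<le> d \<kappa> \<and> pre \<kappa> (\<mu> \<odot> act k y') \<and> pre \<kappa> (\<nu> \<odot> y')"
      unfolding y_def by blast
  qed
  then show ?thesis using \<nu>(3) by blast
qed

text \<open>For infinite paths \<open>w\<close> starting with \<open>\<eta>\<close> both triples
  compute \<mu> (g \<cdot> w), whence \<nu>' (k \<cdot> w) = \<nu> w with k = - g' + g. Comparing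
  prefixes gives \<nu>' = \<nu>, and then k fixes every such \<open>w\<close>. So \<open>k\<close>
  fixes \<open>\<eta>\<close>, its restriction there is trivial by local faithfulness, and pseudo
  freeness gives k = 0.\<close>

lemma cyc_determined:
  assumes lf: "locally_faithful \<Lambda> act" and pf: "pseudo_free \<Lambda> act res"
    and c1: "cyc \<mu> g' \<nu>'" and c2: "cyc (\<mu> \<odot> act g \<eta>) (res g \<eta>) (\<nu> \<odot> \<eta>)"
    and M: "\<eta> \<in> M" "\<nu> \<in> M" and re: "r \<eta> = s \<nu>" and sm: "s \<mu> = act g (s \<nu>)" and dn: "d \<nu>' = d \<nu>"
  shows "\<nu>' = \<nu>" "g' = g"
proof -
  define k where "k = - g' + g"
  note c = cycD[OF c1]
  have g: "act g' (act k w) = act g w" if "w \<in> M" for w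
  proof -
    have "g' + k = g" by (simp add: k_def add.assoc[symmetric])
    then show ?thesis using act_simps(6)[OF that, of g' k] by simp
  qed
  have rw: "r (act k w) = s \<nu>'" if "w \<in> M" "r w = s \<nu>" for w
  proof -
    have "act g' (r (act k w)) = act g' (s \<nu>')" using g[of "s \<nu>"] that M(2) sm c by simp
    then show ?thesis using act_eq_iff that(1) c(2) by simp
  qed
  \<comment> \<open>Finite form of \<nu>' (k \<cdot> w) = \<nu> w: prefixes pass through \<mu> (g
    \<cdot> w), first by \<open>c1\<close>, then by \<open>c2\<close>.\<close>
  have key: "pre \<alpha> (\<nu> \<odot> w)"
    if y: "y \<in> M" "s \<eta> = r y" "w = \<eta> \<odot> y" and \<alpha>: "pre \<alpha> (\<nu>' \<odot> act k w)" "d \<alpha> \<le> d w" for \<alpha> y w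
  proof -
    have w: "w \<in> M" "r w = s \<nu>" "d w = d \<eta> + d y" using y M re by simp_all
    have "d \<alpha> \<le> d \<mu> + d (act k w)" using \<alpha>(2) w(1) by (simp add: less_eq_vec_def trans_le_add2)
    then have "pre \<alpha> (\<mu> \<odot> act g w)"
      using cyc_pre(2)[OF c1 _ rw[OF w(1,2)] \<alpha>(1)] w(1) g[OF w(1)] by simp
    moreover have "\<mu> \<odot> act g w = \<mu> \<odot> act g \<eta> \<odot> act (res g \<eta>) y"
      unfolding y(3) act_comp(1)[OF M(1) y(1,2)]
      by (rule comp_assoc[symmetric]) (use c M re sm y(1) act_comp(3)[OF M(1) y(1,2)] in simp_all)
    moreover have eq: "\<nu> \<odot> \<eta> \<odot> y = \<nu> \<odot> w" using comp_assoc M y re by simp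
    moreover have "d \<alpha> \<le> d (\<nu> \<odot> \<eta>) + d y"
      using \<alpha>(2) w(3) M re by (simp add: less_eq_vec_def add.assoc trans_le_add2)
    moreover have "r y = s (\<nu> \<odot> \<eta>)" using M re y by simp
    ultimately show "pre \<alpha> (\<nu> \<odot> w)" using cyc_pre(1)[OF c2 y(1)] by metis
  qed
  obtain y where y: "y \<in> M" "s \<eta> = r y" "d y = d \<nu>" using extensionE[OF M(1)] .
  have w: "\<eta> \<odot> y \<in> M" "d (\<eta> \<odot> y) = d \<eta> + d \<nu>" "r (\<eta> \<odot> y) = s \<nu>" using y M re by simp_all
  have "s \<nu>' = r (act k (\<eta> \<odot> y))" using rw[OF w(1,3)] by simp
  then have "pre \<nu>' (\<nu>' \<odot> act k (\<eta> \<odot> y))" using c(2) w(1) by (intro preI) simp_all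
  then have "pre \<nu>' (\<nu> \<odot> (\<eta> \<odot> y))"
    using key[OF y(1,2) refl] dn w(2) by (simp add: less_eq_vec_def)
  moreover have "pre \<nu> (\<nu> \<odot> (\<eta> \<odot> y))" using M(2) w by (intro preI) simp_all
  ultimately show \<nu>': "\<nu>' = \<nu>" using pre_unique dn by blast
  have fixed: "act k \<eta> = \<eta> \<and> act (res k \<eta>) y1 = y1" if y1: "y1 \<in> M" "r y1 = s \<eta>" for y1
  proof -
    \<comment> \<open>The extra degree \<open>d \<nu>\<close> makes room for the prefix
      \<open>\<nu>\<close>, so that \<open>\<nu> \<odot> act k (\<eta> \<odot> y1)\<close> meets the
      degree bound of \<open>key\<close>.\<close>
    obtain y2 where y2: "y2 \<in> M" "s y1 = r y2" "d y2 = d \<nu>" using extensionE[OF y1(1)] .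
    have y: "y1 \<odot> y2 \<in> M" "s \<eta> = r (y1 \<odot> y2)" "d (y1 \<odot> y2) = d y1 + d \<nu>" using y1 y2 by simp_all
    have u: "\<eta> \<odot> y1 \<in> M" "d (\<eta> \<odot> y1) = d \<eta> + d y1" "r (\<eta> \<odot> y1) = s \<nu>" "s (\<eta> \<odot> y1) = r y2"
      using M y1 y2 re by simp_all
    define w where "w = \<eta> \<odot> (y1 \<odot> y2)"
    have w: "w \<in> M" "d w = d \<eta> + (d y1 + d \<nu>)" "r w = s \<nu>" "w = \<eta> \<odot> y1 \<odot> y2"
      using M re y y1 y2 comp_assoc[OF M(1) y1(1) y2(1)] by (simp_all add: w_def)
    have pu: "pre (\<eta> \<odot> y1) w" unfolding w(4) using u y2 by (intro preI) simp_all
    then have pk: "pre (act k (\<eta> \<odot> y1)) (act k w)" by (rule act_pre)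
    have rk: "s \<nu> = r (act k w)" using rw[OF w(1,3)] \<nu>' by simp
    then have rk': "s \<nu> = r (act k (\<eta> \<odot> y1))" using preD(3)[OF pk] by simp
    have "pre (\<nu> \<odot> act k (\<eta> \<odot> y1)) (\<nu>' \<odot> act k w)"
      unfolding \<nu>' using pk pre_comp_cancel[OF M(2) preD(1,2)[OF pk] rk' rk] by simp
    moreover have "d (\<nu> \<odot> act k (\<eta> \<odot> y1)) = d \<nu> + d (act k (\<eta> \<odot> y1))"
      using comp_simps(4)[OF M(2) preD(1)[OF pk] rk'] .
    then have "d (\<nu> \<odot> act k (\<eta> \<odot> y1)) \<le> d w" using u w by (simp add: less_eq_vec_def)
    ultimately have "pre (\<nu> \<odot> act k (\<eta> \<odot> y1)) (\<nu> \<odot> w)"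
      using key[OF y(1,2) w_def] by blast
    then have "pre (act k (\<eta> \<odot> y1)) w"
      using pre_comp_cancel[OF M(2) preD(1)[OF pk] w(1) rk'] w(3) by simp
    then have "act k (\<eta> \<odot> y1) = \<eta> \<odot> y1" using pu pre_unique u(1) by simp
    then have "act k \<eta> \<odot> act (res k \<eta>) y1 = \<eta> \<odot> y1"
      using act_comp(1)[OF M(1) y1(1)] y1(2) by simp
    then show ?thesis
      using comp_cancel[of "act k \<eta>" "act (res k \<eta>) y1" \<eta> y1] act_comp(3)[OF M(1) y1(1)] M(1) y1
      by (metis act_simps(1,2))
  qed
  have k1: "act k \<eta> = \<eta>" using fixed[of "s \<eta>"] M(1) by simp
  have "res k \<eta> = 0" using lf s_verts[OF M(1)] fixed unfolding locally_faithful_def by blast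
  then have "k = 0" using pf M(1) k1 unfolding pseudo_free_def by blast
  then have "g' + (- g' + g) = g'" by (simp add: k_def)
  then show "g' = g" by (simp add: add.assoc[symmetric])
qed

text \<open>The vertex \<open>s \<nu>\<close> takes the place of \<open>\<eta>\<close> in
  \<open>cyc_determined\<close>.\<close>

lemma cyc_unique:
  assumes "locally_faithful \<Lambda> act" "pseudo_free \<Lambda> act res"
    and c1: "cyc \<mu> g' \<nu>'" and c2: "cyc \<mu> g \<nu>" and "d \<nu>' = d \<nu>"
  shows "\<nu>' = \<nu>" "g' = g"
proof -
  note c = cycD[OF c2]
  have "\<mu> \<odot> act g (s \<nu>) = \<mu>" using c comp_id(2) by metis
  then have "cyc (\<mu> \<odot> act g (s \<nu>)) (res g (s \<nu>)) (\<nu> \<odot> s \<nu>)" using c2 c by simp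
  from cyc_determined[OF assms(1,2) c1 this _ c(2) _ c(3) assms(5)]
  show "\<nu>' = \<nu>" "g' = g" using c(2) by simp_all
qed

text \<open>Removing the common prefix of degree \<open>d \<eta>\<close> from the extension leaves a
  cycline triple of the original degrees. By \<open>cyc_same_degree\<close> the path
  \<open>\<mu>\<close> then has some cycline partner, which \<open>cyc_determined\<close> identifies
  as \<open>g\<close> and \<open>\<nu>\<close>.\<close>

lemma cyc_if_cyc_extension:
  assumes "strongly_connected \<Lambda>" "locally_faithful \<Lambda> act" "pseudo_free \<Lambda> act res"
    and c: "cyc (\<mu> \<odot> act g \<eta>) h (\<nu> \<odot> \<eta>)" and h: "h = res g \<eta>"
    and M: "\<eta> \<in> M" "\<mu> \<in> M" "\<nu> \<in> M" and re: "r \<eta> = s \<nu>" and sm: "s \<mu> = act g (s \<nu>)"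
  shows "cyc \<mu> g \<nu>"
proof -
  let ?m = "\<mu> \<odot> act g \<eta>" and ?n = "\<nu> \<odot> \<eta>"
  have m: "?m \<in> M" "d ?m = d \<mu> + d \<eta>" and n: "?n \<in> M" "d ?n = d \<nu> + d \<eta>" using M re sm by simp_all
  have "d \<eta> \<le> d ?m" "d \<eta> \<le> d ?n" unfolding m n by (simp_all add: less_eq_vec_def)
  then obtain \<kappa> where k: "pre \<kappa> ?m" "d \<kappa> = d \<eta>" using pre_ex[OF m(1)] by blast
  have "?m \<odot> act h (s ?n) = ?m" using comp_id(2) cycD[OF c] by metis
  then have "pre \<kappa> ?n"
    using cyc_pre(1)[OF c, of "s ?n" \<kappa>] k n \<open>d \<eta> \<le> d ?n\<close> by simp
  then obtain \<mu>' \<nu>' where *: "\<kappa> \<in> M" "\<mu>' \<in> M" "s \<kappa> = r \<mu>'" "?m = \<kappa> \<odot> \<mu>'" "\<nu>' \<in> M" "s \<kappa> = r \<nu>'" "?n = \<kappa> \<odot> \<nu>'"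
    using k by (metis preE)
  have "d \<kappa> + d \<mu>' = d \<mu> + d \<eta>" "d \<kappa> + d \<nu>' = d \<nu> + d \<eta>" using * m n comp_simps(4) by metis+
  then have deg: "d \<mu>' = d \<mu>" "d \<nu>' = d \<nu>" using k(2) by (simp_all add: vec_eq_iff)
  have "cyc \<mu>' h \<nu>'" using c cyc_comp_left[OF *(1,2,5,3,6)] *(4,7) by simp
  then obtain g' \<nu>'' where "cyc \<mu> g' \<nu>''" "d \<nu>'' = d \<nu>"
    using cyc_same_degree[OF assms(1) _ M(2)] deg by metis
  then show ?thesis
    using cyc_determined[OF assms(2,3) _ c[unfolded h] M(1,3) re sm] by metis
qed

end

section \<open>KMS states\<close>

lemma adj_cscale: "cstar_adj (cscale c a) = cscale (cnj c) (cstar_adj (a::'a::cstar_algebra))"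
  by (simp add: cscale_def adj_add adj_scaleR adj_mult adj_iunit iunit_central)

lemma cscale_mult:
  fixes a b :: "'a::cstar_algebra"
  shows "cscale c a * b = cscale c (a * b)" "a * cscale c b = cscale c (a * b)"
proof -
  show "cscale c a * b = cscale c (a * b)"
    by (simp add: cscale_def distrib_right mult.assoc)
  have "a * (iunit * b) = iunit * (a * b)" by (metis iunit_central mult.assoc)
  then show "a * cscale c b = cscale c (a * b)"
    by (simp add: cscale_def distrib_left)
qed

lemma state_zero: "is_state \<phi> \<Longrightarrow> \<phi> 0 = 0"
  unfolding is_state_def by (metis add_cancel_right_left)

lemma state_sum: "is_state \<phi> \<Longrightarrow> \<phi> (sum f A) = (\<Sum>a\<in>A. \<phi> (f a))"
proof (induction A rule: infinite_finite_induct)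
  case (insert a A)
  then show ?case by (simp add: is_state_def)
qed (simp_all add: state_zero)

text \<open>The degenerate case of Cauchy-Schwarz: the value of \<open>\<phi>\<close> on the square
  of c a + b has no quadratic term in c, and a real affine function that stays nonnegative is
  constant. Real and imaginary c, together with realness of the values, give four equations.\<close>

lemma state_null:
  fixes a b :: "'a::cstar_algebra"
  assumes st: "is_state \<phi>" and null: "\<phi> (cstar_adj a * a) = 0"
  shows "\<phi> (cstar_adj a * b) = 0" "\<phi> (cstar_adj b * a) = 0"
proof -
  let ?A = "\<phi> (cstar_adj a * b)" and ?B = "\<phi> (cstar_adj b * a)" and ?D = "\<phi> (cstar_adj b * b)"
  have add: "\<phi> (u + v) = \<phi> u + \<phi> v" and sc: "\<phi> (cscale c u) = c * \<phi> u"
    and pos: "Im (\<phi> (cstar_adj u * u)) = 0" "Re (\<phi> (cstar_adj u * u)) \<ge> 0" for c u v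
    using st by (auto simp: is_state_def)
  have q: "\<phi> (cstar_adj (cscale c a + b) * (cscale c a + b)) = cnj c * ?A + c * ?B + ?D" for c
    by (simp add: adj_add adj_cscale distrib_left distrib_right cscale_mult add sc null)
  have im: "Im (cnj c * ?A + c * ?B) = 0" for c
    using pos(1)[of "cscale c a + b"] pos(1)[of b] unfolding q by simp
  have re: "Re (cnj c * ?A + c * ?B) + Re ?D \<ge> 0" for c
    using pos(2)[of "cscale c a + b"] unfolding q by simp
  have lin: "u = 0" if "\<And>t::real. t * u + w \<ge> 0" for u w :: real
  proof (rule ccontr)
    assume "u \<noteq> 0"
    then show False using that[of "(- w - 1) / u"] by simp
  qed
  have "Re ?A + Re ?B = 0"
    by (rule lin[of _ "Re ?D"]) (use re[of "complex_of_real _"] in \<open>simp add: algebra_simps\<close>)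
  moreover have "Im ?A - Im ?B = 0"
    by (rule lin[of _ "Re ?D"]) (use re[of "\<i> * complex_of_real _"] in \<open>simp add: algebra_simps\<close>)
  moreover have "Im ?A + Im ?B = 0" using im[of 1] by simp
  moreover have "Re ?B - Re ?A = 0" using im[of \<i>] by simp
  ultimately show "?A = 0" "?B = 0" by (simp_all add: complex_eq_iff)
qed

locale kms = kgr \<Lambda> for \<Lambda> :: "('p, 'k::finite) kgraph" +
  fixes act :: "'g::group_add \<Rightarrow> 'p \<Rightarrow> 'p" and res :: "'g \<Rightarrow> 'p \<Rightarrow> 'g"
    and U :: "'g \<Rightarrow> 'a::cstar_algebra" and S :: "'p \<Rightarrow> 'a" and \<phi> :: "'a \<Rightarrow> complex"
  assumes source_free: "source_free \<Lambda>"
    and finite_kgraph: "finite_kgraph \<Lambda>"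
    and strongly_connected: "strongly_connected \<Lambda>"
    and self_similar: "self_similar \<Lambda> act res"
    and ck: "ck_family \<Lambda> act res U S"
    and kms: "is_KMS \<Lambda> act U S \<phi>"
begin

section \<open>Cuntz-Krieger relations and the KMS condition\<close>

lemma finite_paths [simp]: "finite (paths v n)"
  using finite_kgraph unfolding finite_kgraph_def paths_def
  by (auto intro: rev_finite_subset[of "{\<mu> \<in> M. d \<mu> = n}"])

lemma finite_verts [simp]: "finite (verts \<Lambda>)"
  using finite_kgraph unfolding finite_kgraph_def verts_def by simp

lemma ckD:
  shows "v \<in> verts \<Lambda> \<Longrightarrow> cstar_adj (S v) = S v" "v \<in> verts \<Lambda> \<Longrightarrow> S v * S v = S v"
    "v \<in> verts \<Lambda> \<Longrightarrow> w \<in> verts \<Lambda> \<Longrightarrow> v \<noteq> w \<Longrightarrow> S v * S w = 0"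
    "\<mu> \<in> M \<Longrightarrow> \<nu> \<in> M \<Longrightarrow> s \<mu> = r \<nu> \<Longrightarrow> S (\<mu> \<odot> \<nu>) = S \<mu> * S \<nu>"
    "\<mu> \<in> M \<Longrightarrow> cstar_adj (S \<mu>) * S \<mu> = S (s \<mu>)"
    "v \<in> verts \<Lambda> \<Longrightarrow> S v = (\<Sum>\<mu>\<in>paths v n. S \<mu> * cstar_adj (S \<mu>))"
    "U (g + h) = U g * U h" "\<mu> \<in> M \<Longrightarrow> U g * S \<mu> = S (act g \<mu>) * U (res g \<mu>)"
proof -
  note c = ck[unfolded ck_family_def, folded paths_def]
  note c2 = c[THEN conjunct2] note c3 = c2[THEN conjunct2] note c4 = c3[THEN conjunct2]
  note c5 = c4[THEN conjunct2] note c6 = c5[THEN conjunct2] note c7 = c6[THEN conjunct2]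
  show "v \<in> verts \<Lambda> \<Longrightarrow> cstar_adj (S v) = S v" "v \<in> verts \<Lambda> \<Longrightarrow> S v * S v = S v"
    using c2[THEN conjunct1] by blast+
  show "v \<in> verts \<Lambda> \<Longrightarrow> w \<in> verts \<Lambda> \<Longrightarrow> v \<noteq> w \<Longrightarrow> S v * S w = 0"
    using c3[THEN conjunct1] by blast
  show "\<mu> \<in> M \<Longrightarrow> \<nu> \<in> M \<Longrightarrow> s \<mu> = r \<nu> \<Longrightarrow> S (\<mu> \<odot> \<nu>) = S \<mu> * S \<nu>"
    using c4[THEN conjunct1] by blast
  show "\<mu> \<in> M \<Longrightarrow> cstar_adj (S \<mu>) * S \<mu> = S (s \<mu>)"
    using c5[THEN conjunct1] by blast
  show "v \<in> verts \<Lambda> \<Longrightarrow> S v = (\<Sum>\<mu>\<in>paths v n. S \<mu> * cstar_adj (S \<mu>))"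
    using c6[THEN conjunct1] by blast
  show "U (g + h) = U g * U h" using c7[THEN conjunct1] by blast
  show "\<mu> \<in> M \<Longrightarrow> U g * S \<mu> = S (act g \<mu>) * U (res g \<mu>)" using c7[THEN conjunct2] by blast
qed

lemma U_unitary: "cstar_adj (U g) * U g = 1" "U g * cstar_adj (U g) = 1"
  using ck[unfolded ck_family_def, THEN conjunct1] by blast+

lemma U_zero: "U 0 = 1"
proof -
  have "cstar_adj (U 0) * (U 0 * U 0) = cstar_adj (U 0) * U 0" using ckD(7)[of 0 0] by simp
  then show ?thesis using U_unitary(1)[of 0] by (simp add: mult.assoc[symmetric])
qed

lemma S_id:
  assumes "\<mu> \<in> M"
  shows "S (r \<mu>) * S \<mu> = S \<mu>" "S \<mu> * S (s \<mu>) = S \<mu>"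
    "cstar_adj (S \<mu>) * S (r \<mu>) = cstar_adj (S \<mu>)" "S (s \<mu>) * cstar_adj (S \<mu>) = cstar_adj (S \<mu>)"
    "S \<mu> * cstar_adj (S \<mu>) * S \<mu> = S \<mu>"
proof -
  show 1: "S (r \<mu>) * S \<mu> = S \<mu>" using ckD(4)[of "r \<mu>" \<mu>] assms by simp
  show 2: "S \<mu> * S (s \<mu>) = S \<mu>" using ckD(4)[of \<mu> "s \<mu>"] assms by simp
  show "cstar_adj (S \<mu>) * S (r \<mu>) = cstar_adj (S \<mu>)"
    using arg_cong[OF 1, of cstar_adj] ckD(1)[OF r_verts[OF assms]] by (simp add: adj_mult)
  show "S (s \<mu>) * cstar_adj (S \<mu>) = cstar_adj (S \<mu>)"
    using arg_cong[OF 2, of cstar_adj] ckD(1)[OF s_verts[OF assms]] by (simp add: adj_mult)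
  show "S \<mu> * cstar_adj (S \<mu>) * S \<mu> = S \<mu>" using ckD(5)[OF assms] 2 by (simp add: mult.assoc)
qed

lemma state: "is_state \<phi>"
  using kms unfolding is_KMS_def by blast

lemma rho_pow_zero [simp]: "rho_pow \<Lambda> 0 = 1"
  by (simp add: rho_pow_def)

lemma rho_pow_axis: "rho_pow \<Lambda> (axis i 1) = rho \<Lambda> i"
proof -
  have "rho_pow \<Lambda> (axis i 1) = (\<Prod>j\<in>UNIV. if j = i then rho \<Lambda> i else 1)"
    unfolding rho_pow_def by (rule prod.cong) (auto simp: axis_def)
  then show ?thesis by (simp add: prod.delta)
qed

lemma act_zero: "\<mu> \<in> M \<Longrightarrow> act 0 \<mu> = \<mu>"
  using self_similar unfolding self_similar_def by blast

text \<open>\<open>S \<kappa>\<close> has the form required by the KMS condition, with the neutral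
  group element and the vertex \<open>s \<kappa>\<close> as second path.\<close>

lemma kms_S:
  assumes "\<kappa> \<in> M"
  shows "\<phi> (S \<kappa> * y) = \<phi> (y * S \<kappa>) / rho_pow \<Lambda> (d \<kappa>)"
proof -
  have "S \<kappa> * U 0 * cstar_adj (S (s \<kappa>)) = S \<kappa>"
    using S_id(2)[OF assms] ckD(1)[OF s_verts[OF assms]] by (simp add: U_zero)
  moreover have "s \<kappa> = act 0 (s (s \<kappa>))" using assms act_zero by simp
  then have "\<phi> (S \<kappa> * U 0 * cstar_adj (S (s \<kappa>)) * y) =
      complex_of_real (rho_pow \<Lambda> (d (s \<kappa>)) / rho_pow \<Lambda> (d \<kappa>)) *
        \<phi> (y * (S \<kappa> * U 0 * cstar_adj (S (s \<kappa>))))"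
    using kms assms rs_simps(2)[OF assms] unfolding is_KMS_def by blast
  ultimately show ?thesis using assms by simp
qed

text \<open>Range projections have degree difference zero and so lie in the centralizer of
  \<open>\<phi>\<close>. The assumption excludes the convention 0 / 0 = 0 in the quotient of equal
  powers.\<close>

lemma kms_proj:
  assumes "\<kappa> \<in> M" "rho_pow \<Lambda> (d \<kappa>) \<noteq> 0"
  shows "\<phi> (S \<kappa> * cstar_adj (S \<kappa>) * y) = \<phi> (y * (S \<kappa> * cstar_adj (S \<kappa>)))"
proof -
  have "s \<kappa> = act 0 (s \<kappa>)" using assms(1) act_zero by simp
  then have "\<phi> (S \<kappa> * U 0 * cstar_adj (S \<kappa>) * y) =
      complex_of_real (rho_pow \<Lambda> (d \<kappa>) / rho_pow \<Lambda> (d \<kappa>)) * \<phi> (y * (S \<kappa> * U 0 * cstar_adj (S \<kappa>)))"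
    using kms assms(1) unfolding is_KMS_def by blast
  then show ?thesis using assms(2) by (simp add: U_zero)
qed

text \<open>An unnormalized Perron-Frobenius vector: the relations do not force the vertex
  projections to add up to 1, and \<open>x\<close> may even vanish.\<close>

definition x :: "'p \<Rightarrow> real" where "x v = Re (\<phi> (S v))"

lemma state_vertex:
  assumes "v \<in> verts \<Lambda>"
  shows "\<phi> (S v) = complex_of_real (x v)" "x v \<ge> 0"
proof -
  have "S v = cstar_adj (S v) * S v" using ckD(1,2)[OF assms] by simp
  then have "Im (\<phi> (S v)) = 0 \<and> Re (\<phi> (S v)) \<ge> 0" using state unfolding is_state_def by metis
  then show "\<phi> (S v) = complex_of_real (x v)" "x v \<ge> 0" by (simp_all add: x_def complex_eq_iff)
qed

text \<open>Apply \<open>\<phi>\<close> to the Cuntz-Krieger relation and evaluate each range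
  projection by the KMS condition. The sign of \<open>rho_pow\<close> is still open here: a
  vanishing power makes the quotients 0, and positivity of \<open>rho\<close> is later deduced from
  this sum.\<close>

lemma x_sum:
  assumes "v \<in> verts \<Lambda>"
  shows "x v = (\<Sum>\<mu>\<in>paths v n. x (s \<mu>) / rho_pow \<Lambda> n)"
    and "\<mu> \<in> paths v n \<Longrightarrow> x (s \<mu>) / rho_pow \<Lambda> n \<ge> 0"
proof -
  have p: "\<phi> (S \<mu> * cstar_adj (S \<mu>)) = complex_of_real (x (s \<mu>) / rho_pow \<Lambda> n)"
    if "\<mu> \<in> paths v n" for \<mu>
    using that kms_S[of \<mu> "cstar_adj (S \<mu>)"] ckD(5)[of \<mu>] state_vertex(1)[of "s \<mu>"]
    by (simp add: paths_def)
  have "complex_of_real (x v) = (\<Sum>\<mu>\<in>paths v n. \<phi> (S \<mu> * cstar_adj (S \<mu>)))"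
    using state_vertex(1)[OF assms] arg_cong[OF ckD(6)[OF assms, of n], of \<phi>] state_sum[OF state]
    by metis
  also have "\<dots> = complex_of_real (\<Sum>\<mu>\<in>paths v n. x (s \<mu>) / rho_pow \<Lambda> n)"
    using p by simp
  finally show "x v = (\<Sum>\<mu>\<in>paths v n. x (s \<mu>) / rho_pow \<Lambda> n)" by (simp only: of_real_eq_iff)
  show "x (s \<mu>) / rho_pow \<Lambda> n \<ge> 0" if "\<mu> \<in> paths v n"
  proof -
    have "\<phi> (S \<mu> * cstar_adj (S \<mu>)) = \<phi> (cstar_adj (cstar_adj (S \<mu>)) * cstar_adj (S \<mu>))"
      by (simp add: adj_adj)
    then have "Re (\<phi> (S \<mu> * cstar_adj (S \<mu>))) \<ge> 0" using state unfolding is_state_def by metis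
    then show ?thesis using p[OF that] by simp
  qed
qed

definition T :: "'p \<Rightarrow> 'g \<Rightarrow> 'p \<Rightarrow> 'a" where "T \<mu> g \<nu> = S \<mu> * U g * cstar_adj (S \<nu>)"

text \<open>\<open>T \<mu> g \<nu>\<close> absorbs \<open>S (r \<mu>)\<close> on the left, and this
  projection is a null vector of \<open>\<phi>\<close>.\<close>

lemma state_T_degenerate:
  assumes "\<forall>v\<in>verts \<Lambda>. \<phi> (S v) = 0" "\<mu> \<in> M"
  shows "\<phi> (T \<mu> g \<nu>) = 0"
proof -
  have v: "r \<mu> \<in> verts \<Lambda>" using assms by simp
  have "T \<mu> g \<nu> = cstar_adj (S (r \<mu>)) * T \<mu> g \<nu>"
    using ckD(1)[OF v] S_id(1)[OF assms(2)] by (simp add: T_def mult.assoc[symmetric])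
  moreover have "\<phi> (cstar_adj (S (r \<mu>)) * S (r \<mu>)) = 0" using ckD(1,2)[OF v] v assms by simp
  ultimately show ?thesis using state_null(1)[OF state] by metis
qed

end

section \<open>KMS states that do not vanish on all vertex projections\<close>

locale kms_nonzero = kms \<Lambda> act res U S \<phi>
  for \<Lambda> :: "('p, 'k::finite) kgraph"
    and act :: "'g::group_add \<Rightarrow> 'p \<Rightarrow> 'p" and res :: "'g \<Rightarrow> 'p \<Rightarrow> 'g"
    and U :: "'g \<Rightarrow> 'a::cstar_algebra" and S :: "'p \<Rightarrow> 'a" and \<phi> :: "'a \<Rightarrow> complex" +
  assumes nonzero: "\<exists>v\<in>verts \<Lambda>. \<phi> (S v) \<noteq> 0"
begin

text \<open>Positivity comes from the KMS condition instead of spectral theory: for a nonpositive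
  \<open>rho\<close> the sum over edges would make a positive value \<open>x v\<close>
  nonpositive.\<close>

lemma rho_pos: "rho \<Lambda> i > 0"
proof (rule ccontr)
  assume "\<not> rho \<Lambda> i > 0"
  then have rn: "rho \<Lambda> i \<le> 0" by simp
  obtain v where v: "v \<in> verts \<Lambda>" "\<phi> (S v) \<noteq> 0" using nonzero by blast
  have "rho_pow \<Lambda> (axis i 1) \<le> 0" using rn unfolding rho_pow_axis .
  then have "x (s \<mu>) / rho_pow \<Lambda> (axis i 1) \<le> 0" if "\<mu> \<in> paths v (axis i 1)" for \<mu>
    using that state_vertex(2)[of "s \<mu>"] by (simp add: paths_def divide_nonneg_nonpos)
  then have "x v \<le> 0" using x_sum(1)[OF v(1), of "axis i 1"] by (simp add: sum_nonpos)
  then show False using state_vertex[OF v(1)] v(2) by simp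
qed

lemma rho_pow_pos [simp]: "rho_pow \<Lambda> n > 0"
  unfolding rho_pow_def by (simp add: prod_pos rho_pos)

lemma rho_pow_nonzero [simp]: "rho_pow \<Lambda> n \<noteq> 0"
  using rho_pow_pos[of n] by linarith

text \<open>A path from any vertex to one with positive weight contributes a positive term to
  \<open>x_sum\<close>.\<close>

lemma x_pos:
  assumes "v \<in> verts \<Lambda>"
  shows "x v > 0"
proof -
  obtain w where w: "w \<in> verts \<Lambda>" "\<phi> (S w) \<noteq> 0" using nonzero by blast
  then have xw: "x w > 0" using state_vertex[OF w(1)] by (metis of_real_0 order_less_le)
  obtain \<mu> where \<mu>: "\<mu> \<in> M" "r \<mu> = v" "s \<mu> = w"
    using strongly_connected w(1) assms unfolding strongly_connected_def by blast
  then have m: "\<mu> \<in> paths v (d \<mu>)" by (simp add: paths_def)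
  have "0 < x (s \<mu>) / rho_pow \<Lambda> (d \<mu>)" using xw \<mu> by simp
  also have "\<dots> \<le> x v"
    unfolding x_sum(1)[OF assms, of "d \<mu>"]
    by (rule member_le_sum[OF m]) (use x_sum(2)[OF assms] in auto)
  finally show ?thesis .
qed

lemma S_nonzero: "v \<in> verts \<Lambda> \<Longrightarrow> S v \<noteq> 0"
  using x_pos[of v] state_zero[OF state] by (auto simp: x_def)

text \<open>The source identity is read off the algebra: if the two vertices differed, their
  orthogonal projections would force \<open>S (act g \<mu>) = 0\<close>, although every vertex
  projection is nonzero.\<close>

sublocale selfsim \<Lambda> act res
proof
  show "self_similar \<Lambda> act res" "source_free \<Lambda>" by (fact self_similar source_free)+
  fix \<mu> g assume \<mu>: "\<mu> \<in> M"
  have ss: "act h v \<in> verts \<Lambda>" "res h v = h" if "v \<in> verts \<Lambda>" for h v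
    using self_similar that unfolding self_similar_def verts_def by (auto dest: bij_betwE)
  have g: "act g \<mu> \<in> M" "s (act g \<mu>) = act g (s \<mu>)"
    using self_similar \<mu> unfolding self_similar_def by (auto dest: bij_betwE)
  show "act (res g \<mu>) (s \<mu>) = act g (s \<mu>)"
  proof (rule ccontr)
    assume ne: "act (res g \<mu>) (s \<mu>) \<noteq> act g (s \<mu>)"
    let ?h = "res g \<mu>"
    have sv: "s \<mu> \<in> verts \<Lambda>" using \<mu> by simp
    have "S (act g \<mu>) * U ?h = U g * (S \<mu> * S (s \<mu>))"
      using ckD(8)[OF \<mu>] S_id(2)[OF \<mu>] by simp
    also have "\<dots> = S (act g \<mu>) * (U ?h * S (s \<mu>))" using ckD(8)[OF \<mu>] by (metis mult.assoc)
    also have "U ?h * S (s \<mu>) = S (act ?h (s \<mu>)) * U ?h"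
      using ckD(8)[of "s \<mu>" ?h] \<mu> ss(2)[OF sv] by simp
    also have "S (act g \<mu>) * (S (act ?h (s \<mu>)) * U ?h) =
        S (act g \<mu>) * (S (act g (s \<mu>)) * S (act ?h (s \<mu>))) * U ?h"
      using S_id(2)[OF g(1)] g(2) by (simp add: mult.assoc[symmetric])
    also have "S (act g (s \<mu>)) * S (act ?h (s \<mu>)) = 0"
      using ckD(3)[OF ss(1)[OF sv] ss(1)[OF sv]] ne by metis
    finally have "S (act g \<mu>) * U ?h * cstar_adj (U ?h) = 0" by simp
    then have "S (act g \<mu>) = 0" by (simp add: mult.assoc U_unitary)
    then have "S (s (act g \<mu>)) = 0" using ckD(5)[OF g(1)] by simp
    then show False using S_nonzero[OF s_verts[OF g(1)]] by simp
  qed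
qed

text \<open>The Cuntz-Krieger relation at \<open>s \<nu>\<close> is inserted behind
  \<open>U g\<close>, which is then moved past each \<open>S \<eta>\<close>.\<close>

lemma T_expand:
  assumes "\<mu> \<in> M" "\<nu> \<in> M" "s \<mu> = act g (s \<nu>)"
  shows "T \<mu> g \<nu> = (\<Sum>\<eta>\<in>paths (s \<nu>) n. T (\<mu> \<odot> act g \<eta>) (res g \<eta>) (\<nu> \<odot> \<eta>))"
proof -
  have "T \<mu> g \<nu> = S \<mu> * U g * S (s \<nu>) * cstar_adj (S \<nu>)"
    using S_id(4)[OF assms(2)] by (simp add: T_def mult.assoc)
  also have "\<dots> = (\<Sum>\<eta>\<in>paths (s \<nu>) n. S \<mu> * U g * (S \<eta> * cstar_adj (S \<eta>)) * cstar_adj (S \<nu>))"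
    by (subst ckD(6)[of "s \<nu>" n]) (use assms in \<open>simp_all add: sum_distrib_left sum_distrib_right\<close>)
  also have "\<dots> = (\<Sum>\<eta>\<in>paths (s \<nu>) n. T (\<mu> \<odot> act g \<eta>) (res g \<eta>) (\<nu> \<odot> \<eta>))"
  proof (rule sum.cong[OF refl])
    fix \<eta> assume "\<eta> \<in> paths (s \<nu>) n"
    then have \<eta>: "\<eta> \<in> M" "s \<nu> = r \<eta>" by (simp_all add: paths_def)
    have "S (\<mu> \<odot> act g \<eta>) = S \<mu> * S (act g \<eta>)" using ckD(4)[of \<mu> "act g \<eta>"] assms \<eta> by simp
    moreover have "S (\<nu> \<odot> \<eta>) = S \<nu> * S \<eta>" using ckD(4)[OF assms(2) \<eta>] .
    moreover have "U g * (S \<eta> * z) = S (act g \<eta>) * (U (res g \<eta>) * z)" for z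
      using ckD(8)[OF \<eta>(1), of g] by (metis mult.assoc)
    ultimately show "S \<mu> * U g * (S \<eta> * cstar_adj (S \<eta>)) * cstar_adj (S \<nu>) =
        T (\<mu> \<odot> act g \<eta>) (res g \<eta>) (\<nu> \<odot> \<eta>)"
      by (simp add: T_def adj_mult mult.assoc)
  qed
  finally show ?thesis .
qed

text \<open>Testing the orthogonality of range projections against \<open>\<phi>\<close> only, rather than in the algebra,
  avoids the positivity theory of C*-algebras.\<close>

lemma state_range_proj_orthogonal:
  assumes M: "\<kappa> \<in> M" "\<kappa>' \<in> M" and deg: "d \<kappa>' = d \<kappa>" and ne: "\<kappa> \<noteq> \<kappa>'"
  shows "\<phi> (z * (S \<kappa>' * cstar_adj (S \<kappa>') * (S \<kappa> * cstar_adj (S \<kappa>)))) = 0"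
proof -
  let ?p = "\<lambda>\<alpha>. S \<alpha> * cstar_adj (S \<alpha>)"
  have adj: "cstar_adj (?p \<alpha>) = ?p \<alpha>" for \<alpha> by (simp add: adj_mult adj_adj)
  have idem: "?p \<alpha> * ?p \<alpha> = ?p \<alpha>" "S (r \<alpha>) * ?p \<alpha> = ?p \<alpha>" "?p \<alpha> * S (r \<alpha>) = ?p \<alpha>" if "\<alpha> \<in> M" for \<alpha>
    using S_id[OF that] by (metis mult.assoc)+
  have sq: "cstar_adj (?p \<alpha> * ?p \<kappa>) * (?p \<alpha> * ?p \<kappa>) = ?p \<kappa> * ?p \<alpha> * ?p \<kappa>" if "\<alpha> \<in> M" for \<alpha>
    unfolding adj_mult[of "?p \<alpha>"] adj using idem(1)[OF that] by (metis mult.assoc)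
  have "\<phi> (?p \<kappa> * ?p \<kappa>' * ?p \<kappa>) = 0"
  proof (cases "r \<kappa> = r \<kappa>'")
    case False
    have "?p \<kappa>' * ?p \<kappa> = ?p \<kappa>' * (S (r \<kappa>') * S (r \<kappa>)) * ?p \<kappa>"
      using idem(2)[OF M(1)] idem(3)[OF M(2)] by (metis mult.assoc)
    also have "S (r \<kappa>') * S (r \<kappa>) = 0" using ckD(3) M False by simp
    finally have "?p \<kappa>' * ?p \<kappa> = 0" by simp
    then show ?thesis using state_zero[OF state] by (simp only: mult.assoc) simp
  next
    case True
    let ?P = "paths (r \<kappa>) (d \<kappa>)"
    have k: "\<kappa> \<in> ?P" "\<kappa>' \<in> ?P" using M deg True by (simp_all add: paths_def)
    \<comment> \<open>Compress the Cuntz-Krieger relation at \<open>r \<kappa>\<close> by the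
      projection of \<open>\<kappa>\<close>. The summand for \<open>\<kappa>\<close> is already the
      whole, so the others add up to 0, and \<open>\<phi>\<close> is nonnegative on each.\<close>
    have "?p \<kappa> = ?p \<kappa> * S (r \<kappa>) * ?p \<kappa>" using idem(1,3)[OF M(1)] by simp
    also have "\<dots> = (\<Sum>\<alpha>\<in>?P. ?p \<kappa> * ?p \<alpha> * ?p \<kappa>)"
      by (subst ckD(6)[of "r \<kappa>" "d \<kappa>"]) (use M in \<open>simp_all add: sum_distrib_left sum_distrib_right\<close>)
    also have "\<dots> = ?p \<kappa> * ?p \<kappa> * ?p \<kappa> + (\<Sum>\<alpha>\<in>?P - {\<kappa>}. ?p \<kappa> * ?p \<alpha> * ?p \<kappa>)"
      by (rule sum.remove) (use k in auto)
    finally have "(\<Sum>\<alpha>\<in>?P - {\<kappa>}. ?p \<kappa> * ?p \<alpha> * ?p \<kappa>) = 0"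
      using idem(1)[OF M(1)] by simp
    then have "(\<Sum>\<alpha>\<in>?P - {\<kappa>}. \<phi> (?p \<kappa> * ?p \<alpha> * ?p \<kappa>)) = 0"
      using state_sum[OF state, of "\<lambda>\<alpha>. ?p \<kappa> * ?p \<alpha> * ?p \<kappa>" "?P - {\<kappa>}"] state_zero[OF state] by simp
    then have "(\<Sum>\<alpha>\<in>?P - {\<kappa>}. Re (\<phi> (?p \<kappa> * ?p \<alpha> * ?p \<kappa>))) = 0"
      by (metis Re_sum zero_complex.simps(1))
    moreover have pos: "Re (\<phi> (?p \<kappa> * ?p \<alpha> * ?p \<kappa>)) \<ge> 0 \<and> Im (\<phi> (?p \<kappa> * ?p \<alpha> * ?p \<kappa>)) = 0"
      if "\<alpha> \<in> ?P - {\<kappa>}" for \<alpha>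
    proof -
      have a: "\<alpha> \<in> M" using that by (simp add: paths_def)
      have "Im (\<phi> (cstar_adj u * u)) = 0 \<and> Re (\<phi> (cstar_adj u * u)) \<ge> 0" for u
        using state unfolding is_state_def by blast
      from this[of "?p \<alpha> * ?p \<kappa>"] show ?thesis unfolding sq[OF a] by blast
    qed
    ultimately have "\<forall>\<alpha>\<in>?P - {\<kappa>}. Re (\<phi> (?p \<kappa> * ?p \<alpha> * ?p \<kappa>)) = 0"
      using sum_nonneg_eq_0_iff[of "?P - {\<kappa>}" "\<lambda>\<alpha>. Re (\<phi> (?p \<kappa> * ?p \<alpha> * ?p \<kappa>))"] by simp
    then show ?thesis using pos[of \<kappa>'] k(2) ne by (simp add: complex_eq_iff)
  qed
  \<comment> \<open>The product of the two projections is a null vector, so \<open>\<phi>\<close>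
    vanishes on it with any left factor.\<close>
  then have "\<phi> (cstar_adj (?p \<kappa>' * ?p \<kappa>) * (?p \<kappa>' * ?p \<kappa>)) = 0" using sq[OF M(2)] by simp
  from state_null(2)[OF state this, of "cstar_adj z"] show ?thesis by (simp add: adj_adj)
qed

text \<open>For equal prefixes, \<open>S \<kappa>\<close> is cycled to the right by the KMS
  condition and cancels against its adjoint. For different ones, cycling the range projection of
  \<open>\<kappa>\<close> puts it next to that of \<open>\<kappa>'\<close>, where
  \<open>\<phi>\<close> sees 0.\<close>

lemma state_T_prefix:
  assumes M: "\<kappa> \<in> M" "\<kappa>' \<in> M" "\<mu> \<in> M" "\<nu> \<in> M" and sr: "s \<kappa> = r \<mu>" "s \<kappa>' = r \<nu>" and deg: "d \<kappa>' = d \<kappa>"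
  shows "\<phi> (T (\<kappa> \<odot> \<mu>) h (\<kappa>' \<odot> \<nu>)) = (if \<kappa> = \<kappa>' then \<phi> (T \<mu> h \<nu>) / rho_pow \<Lambda> (d \<kappa>) else 0)"
proof -
  have eq: "T (\<kappa> \<odot> \<mu>) h (\<kappa>' \<odot> \<nu>) = S \<kappa> * (T \<mu> h \<nu> * cstar_adj (S \<kappa>'))"
    using ckD(4)[OF M(1,3) sr(1)] ckD(4)[OF M(2,4) sr(2)] by (simp add: T_def adj_mult mult.assoc)
  show ?thesis
  proof (cases "\<kappa> = \<kappa>'")
    case True
    have "T \<mu> h \<nu> * cstar_adj (S \<kappa>) * S \<kappa> = T \<mu> h \<nu>"
      using ckD(5)[OF M(1)] S_id(3)[OF M(4)] sr True by (simp add: T_def mult.assoc)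
    then show ?thesis unfolding eq using kms_S[OF M(1)] True by simp
  next
    case False
    let ?X = "S \<kappa> * (T \<mu> h \<nu> * cstar_adj (S \<kappa>'))"
    let ?p = "S \<kappa> * cstar_adj (S \<kappa>)" and ?p' = "S \<kappa>' * cstar_adj (S \<kappa>')"
    have "cstar_adj (S \<kappa>') * ?p' = cstar_adj (S \<kappa>')"
      using ckD(5)[OF M(2)] S_id(4)[OF M(2)] by (simp add: mult.assoc[symmetric])
    then have X: "?X = ?p * ?X" "?X * ?p' = ?X"
      using S_id(5)[OF M(1)] by (simp add: mult.assoc[symmetric], simp add: mult.assoc)
    have "\<phi> ?X = \<phi> (?p * ?X)" using X(1) by simp
    also have "\<dots> = \<phi> (?X * ?p)" using kms_proj[OF M(1)] by simp
    also have "\<dots> = \<phi> (?X * (?p' * ?p))" using X(2) by (metis mult.assoc)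
    also have "\<dots> = 0" using state_range_proj_orthogonal[OF M(1,2) deg False] .
    finally show ?thesis unfolding eq using False by simp
  qed
qed

end

section \<open>The Perron-Frobenius vector\<close>

context kms_nonzero
begin

text \<open>A simultaneous eigenvector equation, with matrix products written as sums over edges to
  match \<open>x_sum\<close>. Zero and mixed signs are allowed, so the solutions form a vector
  space.\<close>

definition eigenvector :: "('p \<Rightarrow> real) \<Rightarrow> bool" where
  "eigenvector y \<longleftrightarrow> (\<forall>i. \<forall>v\<in>verts \<Lambda>. (\<Sum>e\<in>paths v (axis i 1). y (s e)) = rho \<Lambda> i * y v)"

lemma Tmat_sum:
  assumes "v \<in> verts \<Lambda>"
  shows "(\<Sum>w\<in>verts \<Lambda>. Tmat \<Lambda> i v w * y w) = (\<Sum>e\<in>paths v (axis i 1). y (s e))"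
proof -
  let ?P = "paths v (axis i 1)"
  have "s ` ?P \<subseteq> verts \<Lambda>" by (auto simp: paths_def)
  then have "(\<Sum>e\<in>?P. y (s e)) = (\<Sum>w\<in>verts \<Lambda>. \<Sum>e\<in>{e \<in> ?P. s e = w}. y (s e))"
    by (rule sum.group[OF finite_paths finite_verts, symmetric])
  also have "\<dots> = (\<Sum>w\<in>verts \<Lambda>. real (card {e \<in> ?P. s e = w}) * y w)"
    by (rule sum.cong) simp_all
  also have "\<dots> = (\<Sum>w\<in>verts \<Lambda>. Tmat \<Lambda> i v w * y w)"
    by (rule sum.cong[OF refl]) (simp add: Tmat_def paths_def conj_ac)
  finally show ?thesis by simp
qed

text \<open>At a zero of a nonnegative eigenvector the sum over outgoing edges vanishes, hence each
  term does. The induction on total degree splits one edge off \<open>\<mu>\<close> at a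
  time.\<close>

lemma zero_propagates:
  assumes "eigenvector z" "\<And>v. v \<in> verts \<Lambda> \<Longrightarrow> z v \<ge> 0"
  shows "\<mu> \<in> M \<Longrightarrow> z (r \<mu>) = 0 \<Longrightarrow> z (s \<mu>) = 0"
proof (induction "\<Sum>i\<in>UNIV. d \<mu> $ i" arbitrary: \<mu>)
  case 0
  then have "\<mu> \<in> verts \<Lambda>" by (simp add: verts_def vec_eq_iff)
  then show ?case using 0 vertsD by metis
next
  case (Suc k)
  then have "\<exists>i. d \<mu> $ i \<noteq> 0" by (metis (mono_tags, lifting) Zero_not_Suc sum.neutral)
  then obtain i where i: "d \<mu> $ i \<noteq> 0" ..
  have "d \<mu> = axis i 1 + (d \<mu> - axis i 1)" using i by (auto simp: vec_eq_iff axis_def)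
  from factorE[OF Suc.prems(1) this] obtain e \<mu>' where
    e: "e \<in> M" "\<mu>' \<in> M" "s e = r \<mu>'" "d e = axis i 1" "\<mu> = e \<odot> \<mu>'" by metis
  have "(\<Sum>j\<in>UNIV. axis i (1::nat) $ j) = 1" by (simp add: axis_def)
  moreover have "(\<Sum>j\<in>UNIV. d \<mu> $ j) = (\<Sum>j\<in>UNIV. axis i (1::nat) $ j) + (\<Sum>j\<in>UNIV. d \<mu>' $ j)"
    using e by (simp add: sum.distrib)
  ultimately have k: "k = (\<Sum>j\<in>UNIV. d \<mu>' $ j)" using Suc.hyps(2) by simp
  have re: "r e = r \<mu>" "s \<mu> = s \<mu>'" using e by simp_all
  have "(\<Sum>e\<in>paths (r \<mu>) (axis i 1). z (s e)) = 0"
    using assms(1) Suc.prems unfolding eigenvector_def by simp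
  moreover have "\<forall>e\<in>paths (r \<mu>) (axis i 1). z (s e) \<ge> 0" using assms(2) by (simp add: paths_def)
  ultimately have "\<forall>e\<in>paths (r \<mu>) (axis i 1). z (s e) = 0"
    by (simp add: sum_nonneg_eq_0_iff)
  moreover have "e \<in> paths (r \<mu>) (axis i 1)" using e(1,4) re(1) by (simp add: paths_def)
  ultimately have "z (s e) = 0" by blast
  then show ?case using Suc.hyps(1)[OF k e(2)] e(3) re by metis
qed

lemma eigenvector_x: "eigenvector x"
  unfolding eigenvector_def
proof (intro allI ballI)
  fix i v assume v: "v \<in> verts \<Lambda>"
  show "(\<Sum>e\<in>paths v (axis i 1). x (s e)) = rho \<Lambda> i * x v"
    using x_sum(1)[OF v, of "axis i 1", unfolded rho_pow_axis] rho_pos[of i]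
    by (simp add: sum_divide_distrib[symmetric] del: One_nat_def)
qed

text \<open>Subtract the largest multiple of \<open>x\<close> that keeps the difference nonnegative: the difference
  vanishes somewhere, hence everywhere by irreducibility.\<close>

lemma eigenvector_multiple_of_x:
  assumes y: "eigenvector y"
  shows "\<exists>c. \<forall>v\<in>verts \<Lambda>. y v = c * x v"
proof -
  have ne: "verts \<Lambda> \<noteq> {}" using nonzero by blast
  define c where "c = Min ((\<lambda>v. y v / x v) ` verts \<Lambda>)"
  define z where "z v = y v - c * x v" for v
  have "c \<in> (\<lambda>v. y v / x v) ` verts \<Lambda>" unfolding c_def using ne by (intro Min_in) auto
  then obtain v0 where v0: "v0 \<in> verts \<Lambda>" "c = y v0 / x v0" by blast
  then have z0: "z v0 = 0" using x_pos[OF v0(1)] by (simp add: z_def)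
  have pos: "z v \<ge> 0" if "v \<in> verts \<Lambda>" for v
  proof -
    have "c \<le> y v / x v" unfolding c_def using that by (intro Min_le) auto
    then show ?thesis using x_pos[OF that] by (simp add: z_def field_simps)
  qed
  have z: "eigenvector z"
    using y eigenvector_x unfolding eigenvector_def z_def
    by (simp add: sum_subtractf sum_distrib_left[symmetric] algebra_simps)
  have "z v = 0" if "v \<in> verts \<Lambda>" for v
  proof -
    obtain \<mu> where "\<mu> \<in> M" "r \<mu> = v0" "s \<mu> = v"
      using strongly_connected v0(1) \<open>v \<in> verts \<Lambda>\<close> unfolding strongly_connected_def by blast
    then show ?thesis using zero_propagates[OF z pos] z0 by metis
  qed
  then show ?thesis by (auto simp: z_def)
qed

lemma x_total_pos: "(\<Sum>v\<in>verts \<Lambda>. x v) > 0"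
  using nonzero x_pos by (intro sum_pos) auto

text \<open>The definite description in \<open>pf_vec\<close> denotes: the normalized
  \<open>x\<close> satisfies it, and every solution is a multiple of \<open>x\<close>, fixed by its
  total mass.\<close>

lemma pf_vec_eq:
  assumes v: "v \<in> verts \<Lambda>"
  shows "pf_vec \<Lambda> v = x v / (\<Sum>w\<in>verts \<Lambda>. x w)"
proof -
  let ?X = "\<Sum>w\<in>verts \<Lambda>. x w"
  let ?u = "\<lambda>v. if v \<in> verts \<Lambda> then x v / ?X else 0"
  let ?Q = "\<lambda>y. (\<forall>v\<in>verts \<Lambda>. y v > 0) \<and> (\<forall>v. v \<notin> verts \<Lambda> \<longrightarrow> y v = 0) \<and> (\<Sum>v\<in>verts \<Lambda>. y v) = 1 \<and>
      (\<forall>i. \<forall>v\<in>verts \<Lambda>. (\<Sum>w\<in>verts \<Lambda>. Tmat \<Lambda> i v w * y w) = rho \<Lambda> i * y v)"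
  have X: "?X > 0" by (rule x_total_pos)
  have "(THE y. ?Q y) = ?u"
  proof (rule the_equality)
    have "(\<Sum>w\<in>verts \<Lambda>. Tmat \<Lambda> i v w * ?u w) = rho \<Lambda> i * ?u v" if "v \<in> verts \<Lambda>" for i v
    proof -
      have "(\<Sum>w\<in>verts \<Lambda>. Tmat \<Lambda> i v w * ?u w) = (\<Sum>w\<in>verts \<Lambda>. Tmat \<Lambda> i v w * x w) / ?X"
        unfolding sum_divide_distrib by (rule sum.cong) simp_all
      then show ?thesis
        using Tmat_sum[OF that, of i x] eigenvector_x that unfolding eigenvector_def by simp
    qed
    moreover have "(\<Sum>v\<in>verts \<Lambda>. ?u v) = 1"
      using X by (simp add: sum_divide_distrib[symmetric])
    ultimately show "?Q ?u" using x_pos X by simp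
  next
    fix y assume Q: "?Q y"
    then have "eigenvector y" unfolding eigenvector_def using Tmat_sum by metis
    then obtain c where c: "\<forall>v\<in>verts \<Lambda>. y v = c * x v" using eigenvector_multiple_of_x by blast
    then have "1 = c * ?X" using Q by (simp add: sum_distrib_left)
    then have "c = 1 / ?X" using X by (simp add: field_simps)
    then show "y = ?u" using c Q by (auto simp: fun_eq_iff)
  qed
  then show ?thesis using v by (simp add: pf_vec_def)
qed

section \<open>Triples that are not cycline\<close>

text \<open>In a nonvanishing term the outer paths share the prefix \<open>\<kappa>\<close> by
  \<open>state_T_prefix\<close>. What remains after its removal is still not cycline, for otherwise
  the extension and, by \<open>cyc_if_cyc_extension\<close>, the original triple would be.\<close>

lemma noncyc_descent:
  assumes lf: "locally_faithful \<Lambda> act" and pf: "pseudo_free \<Lambda> act res"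
    and M: "\<mu> \<in> M" "\<nu> \<in> M" and sm: "s \<mu> = act g (s \<nu>)" and nc: "\<not> cyc \<mu> g \<nu>"
    and \<eta>: "\<eta> \<in> M" "r \<eta> = s \<nu>"
    and nz: "\<phi> (T (\<mu> \<odot> act g \<eta>) (res g \<eta>) (\<nu> \<odot> \<eta>)) \<noteq> 0"
  obtains \<kappa> \<mu>' \<nu>' where "d \<kappa> = d \<eta>" "pre \<kappa> (\<mu> \<odot> act g \<eta>)" "pre \<kappa> (\<nu> \<odot> \<eta>)"
    "\<mu>' \<in> M" "\<nu>' \<in> M" "d \<mu>' = d \<mu>" "d \<nu>' = d \<nu>" "s \<nu>' = s \<eta>" "s \<mu>' = act (res g \<eta>) (s \<nu>')"
    "\<not> cyc \<mu>' (res g \<eta>) \<nu>'"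
    "\<phi> (T (\<mu> \<odot> act g \<eta>) (res g \<eta>) (\<nu> \<odot> \<eta>)) = \<phi> (T \<mu>' (res g \<eta>) \<nu>') / rho_pow \<Lambda> (d \<eta>)"
proof -
  let ?m = "\<mu> \<odot> act g \<eta>" and ?n = "\<nu> \<odot> \<eta>" and ?h = "res g \<eta>"
  have m: "?m \<in> M" "d ?m = d \<eta> + d \<mu>" "s ?m = act g (s \<eta>)" and n: "?n \<in> M" "d ?n = d \<eta> + d \<nu>" "s ?n = s \<eta>"
    using M sm \<eta> by (simp_all add: add.commute)
  obtain \<kappa> \<mu>' where k: "\<kappa> \<in> M" "\<mu>' \<in> M" "s \<kappa> = r \<mu>'" "d \<kappa> = d \<eta>" "d \<mu>' = d \<mu>" "?m = \<kappa> \<odot> \<mu>'"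
    using factorE[OF m(1,2)] by metis
  obtain \<kappa>' \<nu>' where k': "\<kappa>' \<in> M" "\<nu>' \<in> M" "s \<kappa>' = r \<nu>'" "d \<kappa>' = d \<eta>" "d \<nu>' = d \<nu>" "?n = \<kappa>' \<odot> \<nu>'"
    using factorE[OF n(1,2)] by metis
  have deg: "d \<kappa>' = d \<kappa>" using k k' by simp
  note T = state_T_prefix[OF k(1) k'(1) k(2) k'(2) k(3) k'(3) deg, of ?h, folded k(6) k'(6)]
  have eq: "\<kappa>' = \<kappa>" using nz T by (auto split: if_splits)
  have s\<nu>': "s \<nu>' = s \<eta>" using n(3) k' comp_simps(3) by metis
  have s\<mu>': "s \<mu>' = act ?h (s \<nu>')"
    using m(3) k comp_simps(3) s\<nu>' act_res_src[OF \<eta>(1)] by metis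
  have "\<not> cyc \<mu>' ?h \<nu>'"
  proof
    assume "cyc \<mu>' ?h \<nu>'"
    then have "cyc ?m ?h ?n"
      using cyc_comp_left[OF k(1,2) k'(2) k(3)] k(6) k'(3,6) eq by simp
    then show False
      using cyc_if_cyc_extension[OF strongly_connected lf pf _ refl \<eta>(1) M \<eta>(2) sm] nc by blast
  qed
  moreover have "pre \<kappa> ?m" "pre \<kappa> ?n"
    using preI[OF k(1-3)] preI[OF k'(1-3)] k(6) k'(6) eq by simp_all
  ultimately show ?thesis
    using that[of \<kappa> \<mu>' \<nu>'] k k' s\<nu>' s\<mu>' T eq by simp
qed

text \<open>By the finite-state condition, only finitely many triples occur when a non-cycline triple is
  restricted repeatedly.  At a triple maximising \<open>|\<phi>(T \<mu> g \<nu>)| / x (s \<nu>)\<close>, expanding along paths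
  long enough to exhibit a mismatch loses a positive fraction of the mass.\<close>

lemma state_T_noncyc:
  assumes lf: "locally_faithful \<Lambda> act" and pf: "pseudo_free \<Lambda> act res" and fs: "finite_state \<Lambda> res"
    and M0: "\<mu>0 \<in> M" "\<nu>0 \<in> M" and s0: "s \<mu>0 = act g0 (s \<nu>0)" and nc0: "\<not> cyc \<mu>0 g0 \<nu>0"
  shows "\<phi> (T \<mu>0 g0 \<nu>0) = 0"
proof -
  \<comment> \<open>The group elements are kept among the restrictions of \<open>g0\<close>, which
    makes \<open>D\<close> finite. The condition \<open>s \<alpha> = s \<nu>\<close> lets a further
    restriction along \<open>\<eta>\<close> be a restriction along
    \<open>\<alpha> \<odot> \<eta>\<close>, so \<open>D\<close> is stable under descent.\<close>
  define D where "D = {(\<mu>, g, \<nu>). \<mu> \<in> M \<and> \<nu> \<in> M \<and> d \<mu> = d \<mu>0 \<and> d \<nu> = d \<nu>0 \<and> s \<mu> = act g (s \<nu>) \<and>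
    \<not> cyc \<mu> g \<nu> \<and> (\<exists>\<alpha>\<in>M. s \<alpha> = s \<nu> \<and> g = res g0 \<alpha>)}"
  define f where "f = (\<lambda>(\<mu>, g, \<nu>). cmod (\<phi> (T \<mu> g \<nu>)) / x (s \<nu>))"
  have "D \<subseteq> {\<mu> \<in> M. d \<mu> = d \<mu>0} \<times> (res g0 ` M) \<times> {\<nu> \<in> M. d \<nu> = d \<nu>0}"
    unfolding D_def by auto
  moreover have "finite ({\<mu> \<in> M. d \<mu> = d \<mu>0} \<times> (res g0 ` M) \<times> {\<nu> \<in> M. d \<nu> = d \<nu>0})"
    using fs finite_kgraph unfolding finite_state_def finite_kgraph_def by (intro finite_cartesian_product) simp_all
  ultimately have fin: "finite D" by (rule finite_subset)
  have "res g0 (s \<nu>0) = g0" using M0 by simp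
  then have D0: "(\<mu>0, g0, \<nu>0) \<in> D"
    unfolding D_def using M0 s0 nc0 by (auto intro!: bexI[of _ "s \<nu>0"])
  define B where "B = Max (f ` D)"
  have fB: "f t \<le> B" if "t \<in> D" for t unfolding B_def using fin that by simp
  have "B \<in> f ` D" unfolding B_def using fin D0 by (intro Max_in) auto
  then obtain \<mu> g \<nu> where t: "(\<mu>, g, \<nu>) \<in> D" and ft: "f (\<mu>, g, \<nu>) = B" by auto
  then obtain \<alpha> where M: "\<mu> \<in> M" "\<nu> \<in> M" and deg: "d \<mu> = d \<mu>0" "d \<nu> = d \<nu>0"
    and sm: "s \<mu> = act g (s \<nu>)" and nc: "\<not> cyc \<mu> g \<nu>" and \<alpha>: "\<alpha> \<in> M" "s \<alpha> = s \<nu>" "g = res g0 \<alpha>"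
    unfolding D_def by auto
  have sv: "s \<nu> \<in> verts \<Lambda>" using M by simp
  \<comment> \<open>Failure of \<open>cyc\<close> at the maximizing triple supplies a path without
    common prefix; by \<open>noncyc_descent\<close> its term in the expansion is 0.\<close>
  obtain \<eta>0 where \<eta>0: "\<eta>0 \<in> M" "r \<eta>0 = s \<nu>"
    and mis: "\<not> (\<exists>\<kappa>. d \<kappa> = d \<eta>0 \<and> pre \<kappa> (\<mu> \<odot> act g \<eta>0) \<and> pre \<kappa> (\<nu> \<odot> \<eta>0))"
    using nc M sm unfolding cyc_def by blast
  let ?P = "paths (s \<nu>) (d \<eta>0)" and ?\<rho> = "rho_pow \<Lambda> (d \<eta>0)"
  let ?c = "\<lambda>\<eta>. cmod (\<phi> (T (\<mu> \<odot> act g \<eta>) (res g \<eta>) (\<nu> \<odot> \<eta>)))"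
  have B0: "B \<ge> 0"
  proof -
    have "0 \<le> f (\<mu>, g, \<nu>)" using x_pos[OF sv] by (simp add: f_def)
    then show ?thesis using ft by simp
  qed
  have c: "?c \<eta> \<le> B * (x (s \<eta>) / ?\<rho>)" and c0: "?c \<eta>0 = 0" if "\<eta> \<in> ?P" for \<eta>
  proof -
    have \<eta>: "\<eta> \<in> M" "r \<eta> = s \<nu>" "d \<eta> = d \<eta>0" using that by (simp_all add: paths_def)
    show "?c \<eta>0 = 0"
      using noncyc_descent[OF lf pf M sm nc \<eta>0] mis by (metis norm_eq_zero)
    show "?c \<eta> \<le> B * (x (s \<eta>) / ?\<rho>)"
    proof (cases "?c \<eta> = 0")
      case True
      have "0 \<le> B * (x (s \<eta>) / ?\<rho>)"
        using B0 x_pos[of "s \<eta>"] \<eta>(1) by (intro mult_nonneg_nonneg divide_nonneg_pos) simp_all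
      then show ?thesis using True by simp
    next
      case False
      then have "\<phi> (T (\<mu> \<odot> act g \<eta>) (res g \<eta>) (\<nu> \<odot> \<eta>)) \<noteq> 0" by simp
      then obtain \<mu>' \<nu>' where t': "\<mu>' \<in> M" "\<nu>' \<in> M" "d \<mu>' = d \<mu>" "d \<nu>' = d \<nu>" "s \<nu>' = s \<eta>"
        "s \<mu>' = act (res g \<eta>) (s \<nu>')" "\<not> cyc \<mu>' (res g \<eta>) \<nu>'"
        "\<phi> (T (\<mu> \<odot> act g \<eta>) (res g \<eta>) (\<nu> \<odot> \<eta>)) = \<phi> (T \<mu>' (res g \<eta>) \<nu>') / rho_pow \<Lambda> (d \<eta>)"
        using noncyc_descent[OF lf pf M sm nc \<eta>(1,2)] by metis
      have a: "\<alpha> \<odot> \<eta> \<in> M" "s (\<alpha> \<odot> \<eta>) = s \<nu>'" "res g \<eta> = res g0 (\<alpha> \<odot> \<eta>)"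
        using \<alpha> \<eta> t'(5) act_comp(2)[OF \<alpha>(1) \<eta>(1)] by simp_all
      have "(\<mu>', res g \<eta>, \<nu>') \<in> D"
        unfolding D_def using t'(1-7) deg a by (auto intro!: bexI[of _ "\<alpha> \<odot> \<eta>"])
      then have "cmod (\<phi> (T \<mu>' (res g \<eta>) \<nu>')) / x (s \<eta>) \<le> B" using fB t'(5) by (fastforce simp: f_def)
      then have "cmod (\<phi> (T \<mu>' (res g \<eta>) \<nu>')) \<le> B * x (s \<eta>)"
        using x_pos[of "s \<eta>"] \<eta>(1) by (simp add: pos_divide_le_eq)
      moreover have "?c \<eta> = cmod (\<phi> (T \<mu>' (res g \<eta>) \<nu>')) / ?\<rho>"
        unfolding t'(8) using \<eta>(3) rho_pow_pos[of "d \<eta>0", THEN less_imp_le]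
        by (simp add: norm_divide)
      ultimately show ?thesis
        using divide_right_mono[OF _ less_imp_le[OF rho_pow_pos[of "d \<eta>0"]]] by simp
    qed
  qed
  have \<eta>0P: "\<eta>0 \<in> ?P" using \<eta>0 by (simp add: paths_def)
  have xs: "(\<Sum>\<eta>\<in>?P - {\<eta>0}. x (s \<eta>) / ?\<rho>) = x (s \<nu>) - x (s \<eta>0) / ?\<rho>"
    using sum.remove[OF finite_paths \<eta>0P, of "\<lambda>\<eta>. x (s \<eta>) / ?\<rho>"] x_sum(1)[OF sv, of "d \<eta>0"]
    by linarith
  \<comment> \<open>The weights \<open>x (s \<eta>) / ?\<rho>\<close> sum to
    \<open>x (s \<nu>)\<close>, so dropping the term of \<open>\<eta>0\<close> leaves a bound
    strictly below \<open>B * x (s \<nu>)\<close> unless \<open>B\<close> is 0.\<close>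
  have "B * x (s \<nu>) = cmod (\<phi> (T \<mu> g \<nu>))" using ft x_pos[OF sv] by (auto simp: f_def)
  also have "\<dots> \<le> (\<Sum>\<eta>\<in>?P. ?c \<eta>)"
    unfolding T_expand[OF M sm, of "d \<eta>0"] state_sum[OF state] by (rule norm_sum)
  also have "\<dots> = (\<Sum>\<eta>\<in>?P - {\<eta>0}. ?c \<eta>)"
    using sum.remove[OF finite_paths \<eta>0P, of ?c] c0[OF \<eta>0P] by simp
  also have "\<dots> \<le> (\<Sum>\<eta>\<in>?P - {\<eta>0}. B * (x (s \<eta>) / ?\<rho>))" by (rule sum_mono) (use c in auto)
  also have "\<dots> = B * x (s \<nu>) - B * (x (s \<eta>0) / ?\<rho>)"
    unfolding sum_distrib_left[symmetric] xs by (rule right_diff_distrib)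
  finally have "B * (x (s \<eta>0) / ?\<rho>) \<le> 0" by simp
  moreover have "x (s \<eta>0) / ?\<rho> > 0" using x_pos[of "s \<eta>0"] \<eta>0(1) rho_pow_pos[of "d \<eta>0"] by simp
  ultimately have "B \<le> 0" by (meson mult_pos_pos not_le)
  then have "f (\<mu>0, g0, \<nu>0) \<le> 0" using fB[OF D0] by simp
  then show ?thesis using x_pos[of "s \<nu>0"] M0 by (simp add: f_def divide_le_0_iff)
qed

section \<open>Cycline triples\<close>

context
  assumes lf: "locally_faithful \<Lambda> act" and pf: "pseudo_free \<Lambda> act res"
begin

text \<open>By \<open>cyc_unique\<close> the value depends only on the first path and the degree of
  the last one. This frees the computation from tracking \<open>g\<close> and
  \<open>\<nu>\<close>.\<close>

definition cval :: "nat^'k \<Rightarrow> 'p \<Rightarrow> complex" where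
  "cval n \<mu> = (THE z. \<exists>g \<nu>. cyc \<mu> g \<nu> \<and> d \<nu> = n \<and> z = \<phi> (T \<mu> g \<nu>))"

lemma cval_eq:
  assumes "cyc \<mu> g \<nu>" "d \<nu> = n"
  shows "cval n \<mu> = \<phi> (T \<mu> g \<nu>)"
  unfolding cval_def
proof (rule the_equality)
  show "\<exists>g' \<nu>'. cyc \<mu> g' \<nu>' \<and> d \<nu>' = n \<and> \<phi> (T \<mu> g \<nu>) = \<phi> (T \<mu> g' \<nu>')" using assms by blast
  fix z assume "\<exists>g' \<nu>'. cyc \<mu> g' \<nu>' \<and> d \<nu>' = n \<and> z = \<phi> (T \<mu> g' \<nu>')"
  then show "z = \<phi> (T \<mu> g \<nu>)" using cyc_unique[OF lf pf _ assms(1)] assms(2) by metis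
qed

text \<open>Extensions of a cycline triple are cycline, so each term of \<open>T_expand\<close> is
  again a value of \<open>cval\<close>. The bijection \<open>act g\<close> moves the index set from
  \<open>s \<nu>\<close> to \<open>s \<mu>\<close>.\<close>

lemma cval_expand:
  assumes c: "cyc \<mu> g \<nu>"
  shows "cval (d \<nu>) \<mu> = (\<Sum>\<eta>\<in>paths (s \<mu>) l. cval (d \<nu> + l) (\<mu> \<odot> \<eta>))"
proof -
  note D = cycD[OF c]
  have bij: "bij_betw (act g) (paths (s \<nu>) l) (paths (s \<mu>) l)"
    by (rule bij_betw_byWitness[where f' = "act (- g)"]) (use D in \<open>auto simp: paths_def\<close>)
  have "cval (d \<nu>) \<mu> = \<phi> (T \<mu> g \<nu>)" using cval_eq[OF c refl] .
  also have "\<dots> = (\<Sum>\<eta>\<in>paths (s \<nu>) l. \<phi> (T (\<mu> \<odot> act g \<eta>) (res g \<eta>) (\<nu> \<odot> \<eta>)))"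
    unfolding T_expand[OF D, of l] by (rule state_sum[OF state])
  also have "\<dots> = (\<Sum>\<eta>\<in>paths (s \<nu>) l. cval (d \<nu> + l) (\<mu> \<odot> act g \<eta>))"
  proof (rule sum.cong[OF refl])
    fix \<eta> assume "\<eta> \<in> paths (s \<nu>) l"
    then have \<eta>: "\<eta> \<in> M" "r \<eta> = s \<nu>" "d \<eta> = l" by (simp_all add: paths_def)
    then have "d (\<nu> \<odot> \<eta>) = d \<nu> + l" using D by simp
    from cval_eq[OF cyc_comp_right[OF c \<eta>(1,2)] this]
    show "\<phi> (T (\<mu> \<odot> act g \<eta>) (res g \<eta>) (\<nu> \<odot> \<eta>)) = cval (d \<nu> + l) (\<mu> \<odot> act g \<eta>)" by simp
  qed
  also have "\<dots> = (\<Sum>\<eta>\<in>paths (s \<mu>) l. cval (d \<nu> + l) (\<mu> \<odot> \<eta>))"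
    by (rule sum.reindex_bij_betw[OF bij])
  finally show ?thesis .
qed

lemma cval_comp_left:
  assumes c: "cyc \<mu> g \<nu>" and \<alpha>: "\<alpha> \<in> M" "s \<alpha> = r \<mu>"
  shows "cval (d \<nu> + d \<alpha>) (\<alpha> \<odot> \<mu>) = cval (d \<nu>) \<mu> / rho_pow \<Lambda> (d \<alpha>)"
proof -
  note D = cycD[OF c]
  have r: "s \<alpha> = r \<nu>" using \<alpha>(2) cyc_rng_eq[OF c] by simp
  have "cyc (\<alpha> \<odot> \<mu>) g (\<alpha> \<odot> \<nu>)" using c cyc_comp_left[OF \<alpha>(1) D(1,2) \<alpha>(2) r] by simp
  moreover have "d (\<alpha> \<odot> \<nu>) = d \<nu> + d \<alpha>" using \<alpha>(1) D r by (simp add: add.commute)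
  ultimately have "cval (d \<nu> + d \<alpha>) (\<alpha> \<odot> \<mu>) = \<phi> (T (\<alpha> \<odot> \<mu>) g (\<alpha> \<odot> \<nu>))" by (rule cval_eq)
  then show ?thesis
    using state_T_prefix[OF \<alpha>(1) \<alpha>(1) D(1,2) \<alpha>(2) r refl] cval_eq[OF c refl] by simp
qed

context
  fixes m n :: "nat^'k"
  assumes period: "\<exists>\<mu> g \<nu>. cyc \<mu> g \<nu> \<and> d \<mu> = m \<and> d \<nu> = n"
begin

lemma cyc_exists:
  assumes "\<mu> \<in> M" "d \<mu> = m"
  obtains g \<nu> where "cyc \<mu> g \<nu>" "d \<nu> = n"
  using period cyc_same_degree[OF strongly_connected _ assms(1)] assms(2) by metis

text \<open>The contribution to \<open>\<phi> (Vmn \<Lambda> act res U S m n)\<close> of the triples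
  whose first path has range \<open>v\<close>.\<close>

definition y :: "'p \<Rightarrow> complex" where "y v = (\<Sum>\<mu>\<in>paths v m. cval n \<mu>)"

text \<open>Each \<open>\<mu>\<close> is extended at its source by degree \<open>l\<close>; the
  resulting paths of degree \<open>m + l\<close> are factored again as \<open>l + m\<close>, and the
  front factor is removed at the cost of \<open>rho_pow \<Lambda> l\<close>.\<close>

lemma y_sum:
  assumes v: "v \<in> verts \<Lambda>"
  shows "y v = (\<Sum>\<alpha>\<in>paths v l. y (s \<alpha>) / rho_pow \<Lambda> l)"
proof -
  have "y v = (\<Sum>\<mu>\<in>paths v m. \<Sum>\<eta>\<in>paths (s \<mu>) l. cval (n + l) (\<mu> \<odot> \<eta>))"
    unfolding y_def
  proof (rule sum.cong[OF refl])
    fix \<mu> assume "\<mu> \<in> paths v m"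
    then obtain g \<nu> where "cyc \<mu> g \<nu>" "d \<nu> = n" using cyc_exists by (auto simp: paths_def)
    then show "cval n \<mu> = (\<Sum>\<eta>\<in>paths (s \<mu>) l. cval (n + l) (\<mu> \<odot> \<eta>))" using cval_expand by blast
  qed
  also have "\<dots> = (\<Sum>\<beta>\<in>paths v (m + l). cval (n + l) \<beta>)"
    by (rule sum_paths_add[OF finite_paths, symmetric])
  also have "\<dots> = (\<Sum>\<beta>\<in>paths v (l + m). cval (n + l) \<beta>)" by (simp add: add.commute)
  also have "\<dots> = (\<Sum>\<alpha>\<in>paths v l. \<Sum>\<mu>\<in>paths (s \<alpha>) m. cval (n + l) (\<alpha> \<odot> \<mu>))"
    by (rule sum_paths_add[OF finite_paths])
  also have "\<dots> = (\<Sum>\<alpha>\<in>paths v l. \<Sum>\<mu>\<in>paths (s \<alpha>) m. cval n \<mu> / rho_pow \<Lambda> l)"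
  proof (intro sum.cong[OF refl])
    fix \<alpha> \<mu> assume "\<alpha> \<in> paths v l" "\<mu> \<in> paths (s \<alpha>) m"
    then have a: "\<alpha> \<in> M" "d \<alpha> = l" "s \<alpha> = r \<mu>" "\<mu> \<in> M" "d \<mu> = m" by (simp_all add: paths_def)
    obtain g \<nu> where "cyc \<mu> g \<nu>" "d \<nu> = n" using cyc_exists[OF a(4,5)] .
    then show "cval (n + l) (\<alpha> \<odot> \<mu>) = cval n \<mu> / rho_pow \<Lambda> l"
      using cval_comp_left[OF _ a(1,3)] a(2) by blast
  qed
  also have "\<dots> = (\<Sum>\<alpha>\<in>paths v l. y (s \<alpha>) / rho_pow \<Lambda> l)"
    by (simp add: y_def sum_divide_distrib)
  finally show ?thesis .
qed

text \<open>Extending \<open>\<mu>\<close> by paths \<open>\<eta>\<close> of the same degree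
  \<open>m\<close> allows \<open>\<mu>\<close> itself to be removed as the prefix, which leaves the
  values at all \<open>\<eta>\<close> with range \<open>s \<mu>\<close>.\<close>

lemma cval_y:
  assumes "\<mu> \<in> M" "d \<mu> = m"
  shows "cval n \<mu> = y (s \<mu>) / rho_pow \<Lambda> m"
proof -
  obtain g \<nu> where c: "cyc \<mu> g \<nu>" "d \<nu> = n" using cyc_exists[OF assms] .
  have "cval n \<mu> = (\<Sum>\<eta>\<in>paths (s \<mu>) m. cval (n + m) (\<mu> \<odot> \<eta>))" using cval_expand[OF c(1)] c(2) by blast
  also have "\<dots> = (\<Sum>\<eta>\<in>paths (s \<mu>) m. cval n \<eta> / rho_pow \<Lambda> m)"
  proof (intro sum.cong[OF refl])
    fix \<eta> assume "\<eta> \<in> paths (s \<mu>) m"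
    then have a: "\<eta> \<in> M" "d \<eta> = m" "s \<mu> = r \<eta>" by (simp_all add: paths_def)
    obtain h \<kappa> where "cyc \<eta> h \<kappa>" "d \<kappa> = n" using cyc_exists[OF a(1,2)] .
    then show "cval (n + m) (\<mu> \<odot> \<eta>) = cval n \<eta> / rho_pow \<Lambda> m"
      using cval_comp_left[OF _ assms(1) a(3)] assms(2) by blast
  qed
  also have "\<dots> = y (s \<mu>) / rho_pow \<Lambda> m" by (simp add: y_def sum_divide_distrib)
  finally show ?thesis .
qed

text \<open>The first component identifies the cycline triples of degrees \<open>m\<close> and
  \<open>n\<close> with all paths of degree \<open>m\<close>: injectively by
  \<open>cyc_unique\<close>, surjectively by \<open>cyc_exists\<close>.\<close>

lemma state_Vmn: "\<phi> (Vmn \<Lambda> act res U S m n) = (\<Sum>v\<in>verts \<Lambda>. y v)"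
proof -
  let ?C = "{t \<in> cycline \<Lambda> act res. d (fst t) = m \<and> d (snd (snd t)) = n}"
  let ?L = "{\<mu> \<in> M. d \<mu> = m}"
  have C: "(\<mu>, g, \<nu>) \<in> ?C \<longleftrightarrow> cyc \<mu> g \<nu> \<and> d \<mu> = m \<and> d \<nu> = n" for \<mu> g \<nu>
    by (simp add: cycline_iff)
  have bij: "bij_betw fst ?C ?L"
  proof (rule bij_betw_imageI)
    show "inj_on fst ?C"
    proof (rule inj_onI)
      fix t t' assume t: "t \<in> ?C" "t' \<in> ?C" "fst t = fst t'"
      obtain \<mu> g \<nu> \<mu>' g' \<nu>' where e: "t = (\<mu>, g, \<nu>)" "t' = (\<mu>', g', \<nu>')" by (metis prod_cases3)
      have "cyc \<mu> g \<nu>" "cyc \<mu> g' \<nu>'" "d \<nu> = d \<nu>'" using t unfolding e by (simp_all add: cycline_iff)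
      then show "t = t'" using cyc_unique[OF lf pf] t(3) unfolding e by simp
    qed
    show "fst ` ?C = ?L"
    proof (intro equalityI subsetI)
      fix \<mu> assume "\<mu> \<in> fst ` ?C"
      then obtain g \<nu> where "(\<mu>, g, \<nu>) \<in> ?C" by (metis (no_types, lifting) imageE prod.collapse)
      then show "\<mu> \<in> ?L" using C cycD(1) by blast
    next
      fix \<mu> assume \<mu>: "\<mu> \<in> ?L"
      then obtain g \<nu> where "cyc \<mu> g \<nu>" "d \<nu> = n" using cyc_exists by blast
      then have "(\<mu>, g, \<nu>) \<in> ?C" using C \<mu> by blast
      then show "\<mu> \<in> fst ` ?C" by (rule image_eqI[rotated]) simp
    qed
  qed
  have "\<phi> (Vmn \<Lambda> act res U S m n) = (\<Sum>t\<in>?C. \<phi> (case t of (\<mu>, g, \<nu>) \<Rightarrow> S \<mu> * U g * cstar_adj (S \<nu>)))"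
    unfolding Vmn_def by (rule state_sum[OF state])
  also have "\<dots> = (\<Sum>t\<in>?C. cval n (fst t))"
  proof (rule sum.cong[OF refl])
    fix t assume t: "t \<in> ?C"
    obtain \<mu> g \<nu> where e: "t = (\<mu>, g, \<nu>)" by (metis prod_cases3)
    then have "cyc \<mu> g \<nu>" "d \<nu> = n" using t C by blast+
    then show "\<phi> (case t of (\<mu>, g, \<nu>) \<Rightarrow> S \<mu> * U g * cstar_adj (S \<nu>)) = cval n (fst t)"
      using cval_eq unfolding e T_def by simp
  qed
  also have "\<dots> = (\<Sum>\<mu>\<in>?L. cval n \<mu>)" by (rule sum.reindex_bij_betw[OF bij])
  also have "\<dots> = (\<Sum>v\<in>verts \<Lambda>. \<Sum>\<mu>\<in>{\<mu> \<in> ?L. r \<mu> = v}. cval n \<mu>)"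
    by (rule sum.group[symmetric])
      (use finite_kgraph in \<open>auto simp: finite_kgraph_def\<close>)
  also have "\<dots> = (\<Sum>v\<in>verts \<Lambda>. y v)"
    unfolding y_def paths_def by (intro sum.cong) auto
  finally show ?thesis .
qed

text \<open>Real and imaginary parts of \<open>y\<close> are eigenvectors by \<open>y_sum\<close>
  along edges, so \<open>y\<close> is a complex multiple of \<open>x\<close>. Summation over the
  vertices identifies the factor.\<close>

lemma y_eq:
  assumes v: "v \<in> verts \<Lambda>"
  shows "y v = complex_of_real (pf_vec \<Lambda> v) * \<phi> (Vmn \<Lambda> act res U S m n)"
proof -
  have edge: "(\<Sum>e\<in>paths v (axis i 1). y (s e)) = rho \<Lambda> i * y v" if "v \<in> verts \<Lambda>" for i v
    using y_sum[OF that, of "axis i 1", unfolded rho_pow_axis] rho_pos[of i]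
    by (simp add: sum_divide_distrib[symmetric] del: One_nat_def)
  have "eigenvector (\<lambda>v. Re (y v))" "eigenvector (\<lambda>v. Im (y v))"
    unfolding eigenvector_def by (simp_all add: edge flip: Re_sum Im_sum del: One_nat_def)
  then obtain a b where "\<forall>v\<in>verts \<Lambda>. Re (y v) = a * x v" "\<forall>v\<in>verts \<Lambda>. Im (y v) = b * x v"
    using eigenvector_multiple_of_x by metis
  then have ab: "y v = Complex a b * x v" if "v \<in> verts \<Lambda>" for v
    using that by (simp add: complex_eq_iff)
  have "\<phi> (Vmn \<Lambda> act res U S m n) = Complex a b * complex_of_real (\<Sum>v\<in>verts \<Lambda>. x v)"
    unfolding state_Vmn of_real_sum sum_distrib_left by (rule sum.cong) (simp_all add: ab)
  then show ?thesis using ab[OF v] pf_vec_eq[OF v] x_total_pos by (simp del: of_real_sum)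
qed

end

end

lemma state_T_cyc:
  assumes "locally_faithful \<Lambda> act" "pseudo_free \<Lambda> act res" and c: "cyc \<mu> g \<nu>"
  shows "\<phi> (T \<mu> g \<nu>) = complex_of_real (pf_vec \<Lambda> (s \<mu>) / rho_pow \<Lambda> (d \<mu>)) *
    \<phi> (Vmn \<Lambda> act res U S (d \<mu>) (d \<nu>))"
proof -
  have p: "\<exists>\<mu>' g' \<nu>'. cyc \<mu>' g' \<nu>' \<and> d \<mu>' = d \<mu> \<and> d \<nu>' = d \<nu>" using c by blast
  note D = cycD[OF c]
  show ?thesis
    using cval_eq[OF assms(1,2) c refl] cval_y[OF assms(1,2) p D(1) refl]
      y_eq[OF assms(1,2) p s_verts[OF D(1)]] by simp
qed

end

section \<open>Combination of the degenerate and the nondegenerate case\<close>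

theorem theorem6p10:
  fixes \<Lambda> :: "('p, 'k::finite) kgraph"
    and act :: "'g::group_add \<Rightarrow> 'p \<Rightarrow> 'p"
    and res :: "'g \<Rightarrow> 'p \<Rightarrow> 'g"
    and U :: "'g \<Rightarrow> 'a::cstar_algebra"
    and S :: "'p \<Rightarrow> 'a"
    and \<phi> :: "'a \<Rightarrow> complex"
  assumes "countable (UNIV :: 'g set)"
    and "amenable TYPE('g)"
    and "is_kgraph \<Lambda>"
    and "row_finite \<Lambda>"
    and "source_free \<Lambda>"
    and "finite_kgraph \<Lambda>"
    and "strongly_connected \<Lambda>"
    and "self_similar \<Lambda> act res"
    and "pseudo_free \<Lambda> act res"
    and "locally_faithful \<Lambda> act"
    and "finite_state \<Lambda> res"
    and "\<forall>g. \<forall>v\<in>verts \<Lambda>. pf_vec \<Lambda> (act g v) = pf_vec \<Lambda> v"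
    and "ck_family \<Lambda> act res U S"
    and "is_KMS \<Lambda> act U S \<phi>"
  shows "\<forall>\<mu>\<in>Mor \<Lambda>. \<forall>\<nu>\<in>Mor \<Lambda>. \<forall>g. src \<Lambda> \<mu> = act g (src \<Lambda> \<nu>) \<longrightarrow>
           \<phi> (S \<mu> * U g * cstar_adj (S \<nu>)) =
             (if (\<mu>, g, \<nu>) \<in> cycline \<Lambda> act res
              then complex_of_real (pf_vec \<Lambda> (src \<Lambda> \<mu>) / rho_pow \<Lambda> (deg \<Lambda> \<mu>)) *
                     \<phi> (Vmn \<Lambda> act res U S (deg \<Lambda> \<mu>) (deg \<Lambda> \<nu>))
              else 0)"
proof -
  interpret kms \<Lambda> act res U S \<phi> by unfold_locales (use assms in auto)
  show ?thesis
  proof (cases "\<forall>v\<in>verts \<Lambda>. \<phi> (S v) = 0")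
    case True
    have "\<phi> (Vmn \<Lambda> act res U S m n) = 0" for m n
      unfolding Vmn_def state_sum[OF state]
      by (intro sum.neutral) (auto simp: cycline_def state_T_degenerate[OF True, unfolded T_def])
    then show ?thesis by (simp add: state_T_degenerate[OF True, unfolded T_def])
  next
    case False
    then interpret kms_nonzero \<Lambda> act res U S \<phi> by unfold_locales blast
    show ?thesis
      using state_T_cyc[OF assms(10,9)] state_T_noncyc[OF assms(10,9,11)]
      unfolding cycline_iff T_def by simp
  qed
qed

end
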